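(* Let $0<\gamma<n$, $1<p<q<\infty$ and $\mu\in\Delta_2$. Given a pair of weights $(w,\nu)$ on $\mathbb R^n$, assume that for some $r>1$ there is a constant $C<\infty$ such that for all cubes $Q$ in $\mathbb R^n$, $$|Q|^{\gamma/n+1/q-1/p}\cdot\bigg(\frac{1}{|Q|}\int_Q w(x)^r\,dx\bigg)^{1/(rq)}\bigg(\frac{1}{|Q|}\int_Q \nu(x)^{-p'/p}\,dx\bigg)^{1/p'}\leq C.$$ If $p\leq\alpha<s\leq\infty$, $1/s=1/\alpha-(1/p-1/q)$ and $w\in\Delta_2$, then the fractional integral operator $I_\gamma$ is bounded from $(L^p,L^s)^{\alpha}(\nu,w;\mu)$ into $(\mathrm{BMO},L^s)(\mu)$.
   Context: A weight on $\mathbb R^n$ is a nonnegative locally integrable function; for a weight $w$ and a measurable set $E$, $w(E)=\int_E w(x)\,dx$, and $|E|$ is Lebesgue measure. $p'=p/(p-1)$. All cubes have sides parallel to the coordinate axes; $Q(y,\ell)$ is the cube centered at $y$ with side length $\ell>0$, and for $\lambda>0$, $\lambda Q(y,\ell):=Q(y,\lambda\sqrt n\,\ell)$. $w\in\Delta_2$ means: $w$ is a weight and there is a finite constant $C>0$ with $w(2Q)\le C\,w(Q)$ for every cube $Q$. Fractional integral operator: for $0<\gamma<n$, $$I_\gamma f(x)=\frac1{\zeta(\gamma)}\int_{\mathbb R^n}\frac{f(y)}{|x-y|^{n-\gamma}}\,dy,\qquad \zeta(\gamma)=\frac{\pi^{n/2}2^\gamma\Gamma(\gamma/2)}{\Gamma((n-\gamma)/2)}.$$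 $\|f\|_{L^p(w)}=(\int_{\mathbb R^n}|f|^pw\,dx)^{1/p}$. Weighted amalgam space: for $1\le p\le\alpha\le s\le\infty$ and weights $\nu,w,\mu$, $(L^p,L^s)^\alpha(\nu,w;\mu)$ is the space of locally integrable $f$ with $$\|f\|_{(L^p,L^s)^\alpha(\nu,w;\mu)}:=\sup_{\ell>0}\Big\|w(Q(y,\ell))^{1/\alpha-1/p-1/s}\|f\cdot\chi_{Q(y,\ell)}\|_{L^p(\nu)}\Big\|_{L^s(\mu)}<\infty,$$ where the $L^s(\mu)$-norm is taken in the variable $y$, i.e. $\|g\|_{L^s(\mu)}=(\int_{\mathbb R^n}|g(y)|^s\mu(y)\,dy)^{1/s}$, with the usual modification when $s=\infty$. The BMO-type space: for $1\le s\le\infty$ and $\mu\in\Delta_2$, $(\mathrm{BMO},L^s)(\mu)$ is the set of locally integrable $f$ with $$\|f\|_{**}:=\sup_{\ell>0}\bigg\|\frac1{|Q(y,\ell)|}\int_{Q(y,\ell)}\big|f(x)-f_{Q(y,\ell)}\big|\,dx\bigg\|_{L^s(\mu)}<\infty,$$ where the $L^s(\mu)$-norm is taken in the variable $y$ and $f_{Q(y,\ell)}$ is the mean value of $f$ on $Q(y,\ell)$. An operator $T$ is bounded from $X$ into $Y$ if there is a constant $C$ with $\|Tf\|_Y\le C\|f\|_X$ for all $f\in X$ (with $\|\cdot\|_{**}$ on $(\mathrm{BMO},L^s)(\mu)$).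
   Formalization: For s=∞ (or μ=0 a.e.) the integral defining I_γ f may diverge everywhere, e.g. w=ν=μ=1, f=|x|^{-γ}; then I_γ f is read as 0. For s<∞, μ not a.e. 0, a.e. convergence is part of the claim. Averages of ν^{-p'/p} are assumed finite, which matters only if w=0 a.e. *)

theory Defs
  imports "HOL-Analysis.Analysis" "HOL-Probability.Essential_Supremum"
begin

definition locally_integrable :: "(real^'n \<Rightarrow> 'b::euclidean_space) \<Rightarrow> bool" where
  "locally_integrable f \<longleftrightarrow> (\<forall>K. compact K \<longrightarrow> f absolutely_integrable_on K)"

definition weight :: "(real^'n \<Rightarrow> real) \<Rightarrow> bool" where
  "weight w \<longleftrightarrow> (\<forall>x. 0 \<le> w x) \<and> locally_integrable w"

definition weight_of :: "(real^'n \<Rightarrow> real) \<Rightarrow> (real^'n) set \<Rightarrow> ennreal" where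
  "weight_of w E = (\<integral>\<^sup>+x\<in>E. ennreal (w x) \<partial>lebesgue)"

definition cube :: "real^'n \<Rightarrow> real \<Rightarrow> (real^'n) set" where
  "cube y l = cbox (\<chi> i. y $ i - l / 2) (\<chi> i. y $ i + l / 2)"

text \<open>The dilate of the cube with centre y and side l: besides the factor lam there is a
  factor given by the square root of the dimension.\<close>
definition dilated_cube :: "real \<Rightarrow> real^'n \<Rightarrow> real \<Rightarrow> (real^'n) set" where
  "dilated_cube lam y l = cube y (lam * sqrt (real CARD('n)) * l)"

definition Delta2 :: "(real^'n \<Rightarrow> real) set" where
  "Delta2 = {w. weight w \<and>
     (\<exists>C>0. \<forall>y l. 0 < l \<longrightarrow> weight_of w (dilated_cube 2 y l) \<le> ennreal C * weight_of w (cube y l))}"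

text \<open>Real powers on the extended half-line, where 0 to a negative power is infinite
  (in contrast to \<^const>\<open>powr\<close> on the reals, which gives 0).  With this convention
  the negative powers of \<open>\<nu> x\<close> and of \<open>weight_of w (cube y l)\<close> used below have
  their usual meaning where the base vanishes.\<close>
definition epowr :: "ennreal \<Rightarrow> real \<Rightarrow> ennreal" where
  "epowr x a =
     (if a = 0 then 1
      else if x = 0 then (if a < 0 then top else 0)
      else if x = top then (if a < 0 then 0 else top)
      else ennreal (enn2real x powr a))"

text \<open>The weighted Lebesgue norm of a nonnegative function, for an exponent that may be
  infinite; in that case it is the essential supremum with respect to the measure
  \<open>\<mu>(y) dy\<close>.\<close>
definition Lnorm :: "ereal \<Rightarrow> (real^'n \<Rightarrow> real) \<Rightarrow> (real^'n \<Rightarrow> ennreal) \<Rightarrow> ennreal" where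
  "Lnorm s \<mu> g =
     (if s = \<infinity> then esssup (density lebesgue (\<lambda>y. ennreal (\<mu> y))) g
      else epowr (\<integral>\<^sup>+y. epowr (g y) (real_of_ereal s) * ennreal (\<mu> y) \<partial>lebesgue)
                 (1 / real_of_ereal s))"

definition amalgam_norm ::
  "ereal \<Rightarrow> ereal \<Rightarrow> ereal \<Rightarrow> (real^'n \<Rightarrow> real) \<Rightarrow> (real^'n \<Rightarrow> real) \<Rightarrow> (real^'n \<Rightarrow> real)
    \<Rightarrow> (real^'n \<Rightarrow> complex) \<Rightarrow> ennreal" where
  "amalgam_norm p s \<alpha> \<nu> w \<mu> f =
     (SUP l\<in>{0<..}. Lnorm s \<mu> (\<lambda>y.
        epowr (weight_of w (cube y l)) (real_of_ereal (1/\<alpha>) - real_of_ereal (1/p) - real_of_ereal (1/s))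
        * Lnorm p \<nu> (\<lambda>x. ennreal (norm (f x)) * indicator (cube y l) x)))"

definition amalgam ::
  "ereal \<Rightarrow> ereal \<Rightarrow> ereal \<Rightarrow> (real^'n \<Rightarrow> real) \<Rightarrow> (real^'n \<Rightarrow> real) \<Rightarrow> (real^'n \<Rightarrow> real)
    \<Rightarrow> (real^'n \<Rightarrow> complex) set" where
  "amalgam p s \<alpha> \<nu> w \<mu> = {f. locally_integrable f \<and> amalgam_norm p s \<alpha> \<nu> w \<mu> f < \<infinity>}"

definition cube_avg :: "(real^'n \<Rightarrow> ennreal) \<Rightarrow> real^'n \<Rightarrow> real \<Rightarrow> ennreal" where
  "cube_avg g y l = (\<integral>\<^sup>+x\<in>cube y l. g x \<partial>lebesgue) / emeasure lebesgue (cube y l)"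

definition cube_mean :: "(real^'n \<Rightarrow> complex) \<Rightarrow> real^'n \<Rightarrow> real \<Rightarrow> complex" where
  "cube_mean f y l = (LINT x:cube y l|lebesgue. f x) /\<^sub>R measure lebesgue (cube y l)"

definition bmo_norm :: "ereal \<Rightarrow> (real^'n \<Rightarrow> real) \<Rightarrow> (real^'n \<Rightarrow> complex) \<Rightarrow> ennreal" where
  "bmo_norm s \<mu> f =
     (SUP l\<in>{0<..}. Lnorm s \<mu> (\<lambda>y. cube_avg (\<lambda>x. ennreal (norm (f x - cube_mean f y l))) y l))"

definition bmo_space :: "ereal \<Rightarrow> (real^'n \<Rightarrow> real) \<Rightarrow> (real^'n \<Rightarrow> complex) set" where
  "bmo_space s \<mu> = {f. locally_integrable f \<and> bmo_norm s \<mu> f < \<infinity>}"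

definition riesz_const :: "real \<Rightarrow> real \<Rightarrow> real" where
  "riesz_const n \<gamma> = pi powr (n/2) * 2 powr \<gamma> * Gamma (\<gamma>/2) / Gamma ((n - \<gamma>)/2)"

definition riesz_integrand :: "real \<Rightarrow> (real^'n \<Rightarrow> complex) \<Rightarrow> real^'n \<Rightarrow> real^'n \<Rightarrow> complex" where
  "riesz_integrand \<gamma> f x y = f y /\<^sub>R norm (x - y) powr (real CARD('n) - \<gamma>)"

text \<open>The Bochner integral is 0 where the integral does not converge absolutely.  For locally
  integrable f and \<open>0 < \<gamma> < n\<close> this happens either only on a null set or at
  every point x.\<close>
definition frac_integral :: "real \<Rightarrow> (real^'n \<Rightarrow> complex) \<Rightarrow> real^'n \<Rightarrow> complex" where
  "frac_integral \<gamma> f x =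
     (1 / riesz_const (real CARD('n)) \<gamma>) *\<^sub>R (LINT y|lebesgue. riesz_integrand \<gamma> f x y)"

definition frac_integral_converges :: "real \<Rightarrow> (real^'n \<Rightarrow> complex) \<Rightarrow> bool" where
  "frac_integral_converges \<gamma> f \<longleftrightarrow> (AE x in lebesgue. integrable lebesgue (riesz_integrand \<gamma> f x))"

definition bounded_operator ::
  "('a \<Rightarrow> 'b) \<Rightarrow> 'a set \<Rightarrow> ('a \<Rightarrow> ennreal) \<Rightarrow> 'b set \<Rightarrow> ('b \<Rightarrow> ennreal) \<Rightarrow> bool" where
  "bounded_operator T X norm_X Y norm_Y \<longleftrightarrow>
     (\<exists>C::real. \<forall>f\<in>X. T f \<in> Y \<and> norm_Y (T f) \<le> ennreal C * norm_X f)"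

definition conj_exp :: "real \<Rightarrow> real" where
  "conj_exp p = p / (p - 1)"

text \<open>The two-weight condition with bump exponent r on the first weight.  It includes
  finiteness of the averages of the negative power of \<open>\<nu>\<close>.  This follows from
  the inequality except when w vanishes almost everywhere, where the convention
  \<open>0 * \<infinity> = 0\<close> of \<^typ>\<open>ennreal\<close> would make the inequality hold
  for every \<open>\<nu>\<close>.\<close>
definition two_weight_bump ::
  "real \<Rightarrow> real \<Rightarrow> real \<Rightarrow> real \<Rightarrow> (real^'n \<Rightarrow> real) \<Rightarrow> (real^'n \<Rightarrow> real) \<Rightarrow> bool" where
  "two_weight_bump \<gamma> p q r w \<nu> \<longleftrightarrow>
     (\<exists>C::real. \<forall>y l. 0 < l \<longrightarrow>
        cube_avg (\<lambda>x. epowr (ennreal (\<nu> x)) (- (conj_exp p / p))) y l < \<infinity> \<and>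
        epowr (emeasure lebesgue (cube y l)) (\<gamma> / real CARD('n) + 1/q - 1/p)
        * epowr (cube_avg (\<lambda>x. epowr (ennreal (w x)) r) y l) (1 / (r * q))
        * epowr (cube_avg (\<lambda>x. epowr (ennreal (\<nu> x)) (- (conj_exp p / p))) y l) (1 / conj_exp p)
        \<le> ennreal C)"

end

theory Submission
  imports Defs
begin

text \<open>Write \<open>n\<close> for the dimension, put \<open>a = n - \<gamma>\<close>, and let \<open>\<Phi>(y, L) = L powr - a * (\<integral>\<^sub>Q \<bar>f\<bar>)\<close>
  with \<open>Q = cube y L\<close> (this is \<open>scaled_mass\<close>). Two estimates carry the theorem.

  The first is pointwise in the centre \<open>y\<close>: the mean oscillation of \<open>I\<^sub>\<gamma> f\<close> over \<open>cube y l\<close> is at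
  most a constant times the sum over \<open>i \<ge> 1\<close> of \<open>\<Phi>(y, 3 ^ i * l) / 3 ^ i\<close>
  (\<open>oscillation_frac_integral_borel\<close>). It bounds the oscillation by a double average over the cube
  of differences of \<open>I\<^sub>\<gamma> f\<close>, and the double average of the corresponding difference of kernels by
  the integrability of the kernel at its singularity near the cube and by the mean value theorem
  far from it (\<open>nn_integral_kernel_diff\<close>).

  The second is \<open>\<Phi>(y, L) \<le> C * w(Q) powr - (1 / q) * \<parallel>f \<chi>\<^sub>Q\<parallel>\<close> with the norm of \<open>L\<^sup>p(\<nu>)\<close>: Hoelder's
  inequality, followed by the two-weight condition (\<open>scaled_mass_le_amalgam_integrand\<close>). Since
  \<open>1 / \<alpha> - 1 / p - 1 / s = - (1 / q)\<close>, the right-hand side is exactly the function of \<open>y\<close> whose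
  \<open>L\<^sup>s(\<mu>)\<close> norm is bounded by the amalgam norm of \<open>f\<close>, uniformly in \<open>L\<close>. All cubes in the first
  estimate have the same centre, so the series can be summed in \<open>L\<^sup>s(\<mu>)\<close> term by term
  (\<open>Lnorm_suminf_le\<close>).

  As for convergence, the integral defining \<open>I\<^sub>\<gamma> f(x)\<close> converges absolutely either for almost
  every \<open>x\<close>, with a locally integrable value, or for no \<open>x\<close>, according to whether
  \<open>\<bar>f(z)\<bar> * (1 + \<bar>z\<bar>) powr - a\<close> is integrable (\<open>finite_tail\<close>). In the second case \<open>frac_integral\<close>
  is the zero function and the norm inequality is trivial. If \<open>s\<close> is finite and \<open>\<mu>\<close> is not zero
  almost everywhere, the second case is excluded: \<open>\<mu>(cube 0 (3 ^ i))\<close> grows geometrically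
  (\<open>reverse_doubling\<close>), so \<open>\<Phi>(0, 3 ^ i)\<close> decays geometrically (\<open>suminf_scaled_mass_finite\<close>).\<close>

section \<open>Powers on the extended half-line, Hoelder and Jensen inequalities\<close>

lemma epowr_ennreal_pos: "0 < x \<Longrightarrow> epowr (ennreal x) a = ennreal (x powr a)"
  by (auto simp: epowr_def)

lemma epowr_ennreal: "0 \<le> x \<Longrightarrow> 0 < a \<Longrightarrow> epowr (ennreal x) a = ennreal (x powr a)"
  by (cases "x = 0") (auto simp: epowr_def)

lemma epowr_zero [simp]: "0 < a \<Longrightarrow> epowr 0 a = 0"
  and epowr_top [simp]: "0 < a \<Longrightarrow> epowr top a = top"
  and epowr_one [simp]: "epowr 1 a = 1"
  and epowr_by_one [simp]: "epowr x 1 = x"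
  by (auto simp: epowr_def less_top)

lemma epowr_eq_0_iff: "0 < a \<Longrightarrow> epowr x a = 0 \<longleftrightarrow> x = 0"
  by (cases x rule: ennreal_cases) (auto simp: epowr_ennreal)

lemma epowr_mono: "x \<le> y \<Longrightarrow> 0 < a \<Longrightarrow> epowr x a \<le> epowr y a"
  by (cases x rule: ennreal_cases; cases y rule: ennreal_cases)
     (auto simp: epowr_ennreal top_unique intro!: ennreal_leI powr_mono2)

lemma epowr_mult: "0 < a \<Longrightarrow> epowr (x * y) a = epowr x a * epowr y a"
  by (cases x rule: ennreal_cases; cases y rule: ennreal_cases)
     (auto simp: epowr_ennreal ennreal_mult[symmetric] powr_mult ennreal_mult_top ennreal_top_mult)

lemma epowr_epowr: "0 < a \<Longrightarrow> 0 < b \<Longrightarrow> epowr (epowr x a) b = epowr x (a * b)"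
  by (cases x rule: ennreal_cases) (auto simp: epowr_ennreal powr_powr)

lemma epowr_cancel: "0 < a \<Longrightarrow> epowr (epowr x a) (1 / a) = x"
  by (subst epowr_epowr) auto

lemma epowr_cancel': "0 < a \<Longrightarrow> epowr (epowr x (1 / a)) a = x"
  by (subst epowr_epowr) auto

lemma measurable_epowr [measurable (raw)]:
  assumes [measurable]: "f \<in> borel_measurable M"
  shows "(\<lambda>x. epowr (f x) a) \<in> borel_measurable M"
  unfolding epowr_def by measurable

lemma ennreal_Young:
  assumes "1 < p" "1 < q" "1 / p + 1 / q = 1"
  shows "x * y \<le> ennreal (1 / p) * epowr x p + ennreal (1 / q) * epowr y q"
proof -
  have "x * y \<le> ennreal (1 / p) * epowr x p + ennreal (1 / q) * epowr y q"
    if "x = ennreal a" "y = ennreal b" "0 \<le> a" "0 \<le> b" for a b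
    using assms that Youngs_inequality[of p q a b]
    by (simp add: epowr_ennreal ennreal_mult[symmetric] ennreal_plus[symmetric] field_simps
        del: ennreal_plus)
  then show ?thesis
    using assms by (cases x rule: ennreal_cases; cases y rule: ennreal_cases)
      (auto simp: ennreal_mult_top)
qed

lemma nn_integral_Holder:
  assumes [measurable]: "f \<in> borel_measurable M" "g \<in> borel_measurable M"
    and pq: "1 < p" "1 < q" "1 / p + 1 / q = 1"
  shows "(\<integral>\<^sup>+x. f x * g x \<partial>M)
    \<le> epowr (\<integral>\<^sup>+x. epowr (f x) p \<partial>M) (1 / p) * epowr (\<integral>\<^sup>+x. epowr (g x) q \<partial>M) (1 / q)"
proof -
  define A B where "A = (\<integral>\<^sup>+x. epowr (f x) p \<partial>M)" and "B = (\<integral>\<^sup>+x. epowr (g x) q \<partial>M)"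
  have null: "(\<integral>\<^sup>+x. f x * g x \<partial>M) = 0" if "A = 0 \<or> B = 0"
  proof -
    have "(AE x in M. f x = 0) \<or> (AE x in M. g x = 0)"
      using that pq unfolding A_def B_def by (auto simp: nn_integral_0_iff_AE epowr_eq_0_iff)
    then have "AE x in M. f x * g x = 0" by auto
    then show ?thesis by (subst nn_integral_0_iff_AE) auto
  qed
  consider "A = 0 \<or> B = 0" | "A \<noteq> 0" "B \<noteq> 0" "A = top \<or> B = top"
    | a b where "A = ennreal a" "B = ennreal b" "0 < a" "0 < b"
    by (cases A rule: ennreal_cases; cases B rule: ennreal_cases) (auto simp: less_le)
  then show ?thesis
  proof cases
    case 1
    then show ?thesis using null by simp
  next
    case 2
    then have "epowr A (1 / p) * epowr B (1 / q) = top"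
      using pq by (auto simp: ennreal_mult_eq_top_iff epowr_eq_0_iff)
    then show ?thesis by (simp add: A_def B_def)
  next
    case 3
    define s t where "s = a powr (1 / p)" and "t = b powr (1 / q)"
    have st: "0 < s" "0 < t" "s powr p = a" "t powr q = b"
      using 3 pq by (auto simp: s_def t_def powr_powr)
    have pt: "f x * g x \<le> ennreal (s * t) *
        (ennreal (1 / (p * a)) * epowr (f x) p + ennreal (1 / (q * b)) * epowr (g x) q)" for x
    proof -
      have eq: "ennreal (1 / s) * ennreal s = 1" "ennreal (1 / t) * ennreal t = 1"
        using st by (auto simp: ennreal_mult[symmetric])
      have "f x * g x = ennreal (s * t) * ((ennreal (1 / s) * f x) * (ennreal (1 / t) * g x))"
        using st eq by (simp add: ennreal_mult mult_ac)
      also have "(ennreal (1 / s) * f x) * (ennreal (1 / t) * g x)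
          \<le> ennreal (1 / p) * epowr (ennreal (1 / s) * f x) p
             + ennreal (1 / q) * epowr (ennreal (1 / t) * g x) q"
        by (rule ennreal_Young[OF pq])
      also have "\<dots> = ennreal (1 / (p * a)) * epowr (f x) p + ennreal (1 / (q * b)) * epowr (g x) q"
      proof -
        have "ennreal (1 / p) * ennreal (1 / a) = ennreal (1 / (p * a))"
             "ennreal (1 / q) * ennreal (1 / b) = ennreal (1 / (q * b))"
          using pq 3 by (auto simp: ennreal_mult[symmetric])
        then show ?thesis
          using st pq by (simp add: epowr_mult epowr_ennreal powr_divide mult.assoc[symmetric])
      qed
      finally show ?thesis by (simp add: mult_left_mono)
    qed
    have "(\<integral>\<^sup>+x. f x * g x \<partial>M) \<le> (\<integral>\<^sup>+x. ennreal (s * t) *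
        (ennreal (1 / (p * a)) * epowr (f x) p + ennreal (1 / (q * b)) * epowr (g x) q) \<partial>M)"
      by (intro nn_integral_mono pt)
    also have "\<dots> = ennreal (s * t) * (ennreal (1 / (p * a)) * A + ennreal (1 / (q * b)) * B)"
      by (simp add: nn_integral_cmult nn_integral_add A_def B_def)
    also have "\<dots> = ennreal (s * t) * ennreal (1 / p + 1 / q)"
      using 3 pq by (simp add: ennreal_mult[symmetric] ennreal_plus[symmetric] del: ennreal_plus)
    also have "\<dots> = ennreal s * ennreal t"
      using pq st by (simp add: ennreal_mult)
    also have "\<dots> = epowr A (1 / p) * epowr B (1 / q)"
      using 3 pq by (simp add: s_def t_def epowr_ennreal)
    finally show ?thesis by (simp add: A_def B_def)
  qed
qed

lemma nn_integral_Jensen_epowr: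
  assumes [measurable]: "f \<in> borel_measurable M" and "emeasure M (space M) \<le> 1" and "1 < p"
  shows "epowr (\<integral>\<^sup>+x. f x \<partial>M) p \<le> (\<integral>\<^sup>+x. epowr (f x) p \<partial>M)"
proof -
  define q where "q = p / (p - 1)"
  have q: "1 < q" "1 / p + 1 / q = 1" using \<open>1 < p\<close> by (auto simp: q_def field_simps)
  have "(\<integral>\<^sup>+x. f x \<partial>M) \<le> epowr (\<integral>\<^sup>+x. epowr (f x) p \<partial>M) (1 / p)
      * epowr (emeasure M (space M)) (1 / q)"
    using nn_integral_Holder[of f M "\<lambda>_. 1" p q] q \<open>1 < p\<close> by simp
  also have "\<dots> \<le> epowr (\<integral>\<^sup>+x. epowr (f x) p \<partial>M) (1 / p) * epowr 1 (1 / q)"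
    using assms q by (intro mult_left_mono epowr_mono) auto
  finally have "epowr (\<integral>\<^sup>+x. f x \<partial>M) p \<le> epowr (epowr (\<integral>\<^sup>+x. epowr (f x) p \<partial>M) (1 / p)) p"
    using \<open>1 < p\<close> by (intro epowr_mono) auto
  then show ?thesis using \<open>1 < p\<close> by (simp add: epowr_cancel')
qed

lemma ennreal_suminf_term_le: "f i \<le> (\<Sum>k. f k)" for f :: "nat \<Rightarrow> ennreal"
  using sum_le_suminf[of f "{i}"] by simp

text \<open>Convexity of the power \<open>p\<close>, for a discrete measure with weights \<open>\<theta> i\<close> of sum at most 1.\<close>

lemma suminf_Jensen_epowr:
  fixes f \<theta> :: "nat \<Rightarrow> ennreal"
  assumes "(\<Sum>i. \<theta> i) \<le> 1" and "1 < p"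
  shows "epowr (\<Sum>i. \<theta> i * f i) p \<le> (\<Sum>i. \<theta> i * epowr (f i) p)"
proof -
  let ?M = "density (count_space UNIV) \<theta>"
  have int: "(\<integral>\<^sup>+i. g i \<partial>?M) = (\<Sum>i. \<theta> i * g i)" for g :: "nat \<Rightarrow> ennreal"
    by (simp add: nn_integral_density nn_integral_count_space_nat)
  have "emeasure ?M (space ?M) \<le> 1"
    using assms int[of "\<lambda>_. 1"] by simp
  from nn_integral_Jensen_epowr[OF _ this \<open>1 < p\<close>, of f] show ?thesis
    by (simp add: int)
qed

section \<open>Cubes\<close>

lemma mem_cube: "x \<in> cube y l \<longleftrightarrow> (\<forall>i. \<bar>x $ i - y $ i\<bar> \<le> l / 2)"
proof -
  have "a - l / 2 \<le> b \<and> b \<le> a + l / 2 \<longleftrightarrow> \<bar>b - a\<bar> \<le> l / 2" for a b :: real by linarith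
  then show ?thesis unfolding cube_def mem_box_cart by simp
qed

lemma cube_commute: "x \<in> cube y l \<longleftrightarrow> y \<in> cube x l"
  by (simp add: mem_cube abs_minus_commute)

lemma compact_cube: "compact (cube y l)"
  by (simp add: cube_def compact_cbox)

lemma sets_cube [measurable, simp]: "cube y l \<in> sets borel"
  by (simp add: cube_def)

lemma sets_cube_lebesgue [measurable, simp]: "cube y l \<in> sets lebesgue"
  by (simp add: cube_def)

lemma cube_mono: "l \<le> m \<Longrightarrow> cube y l \<subseteq> cube y m"
  unfolding mem_cube subset_iff by (meson divide_right_mono order_trans zero_le_numeral)

lemma cube_trans:
  assumes "x \<in> cube y l" "z \<in> cube x m" shows "z \<in> cube y (l + m)"
  unfolding mem_cube
proof
  fix i
  have "\<bar>x $ i - y $ i\<bar> \<le> l / 2" "\<bar>z $ i - x $ i\<bar> \<le> m / 2" using assms by (auto simp: mem_cube)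
  then show "\<bar>z $ i - y $ i\<bar> \<le> (l + m) / 2" unfolding add_divide_distrib by linarith
qed

lemma emeasure_cube: 
  assumes "0 < l" shows "emeasure lborel (cube (y :: real^'n) l) = ennreal (l ^ CARD('n))"
proof -
  have "emeasure lborel (cube y l) = ennreal (measure lborel (cube y l))"
    using emeasure_lborel_cbox_finite unfolding cube_def
    by (intro emeasure_eq_ennreal_measure) (auto simp: less_top)
  also have "measure lborel (cube y l) = l ^ CARD('n)"
    using assms unfolding cube_def
    by (subst content_cbox_cart) (auto simp: interval_ne_empty_cart)
  finally show ?thesis .
qed

lemma norm_le_cube:
  assumes "x \<in> cube (y :: real^'n) l"
  shows "norm (x - y) \<le> real CARD('n) * (l / 2)"
proof -
  have "norm (x - y) \<le> (\<Sum>i\<in>UNIV. \<bar>(x - y) $ i\<bar>)" by (rule norm_le_l1_cart)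
  also have "\<dots> \<le> (\<Sum>i\<in>(UNIV::'n set). l / 2)"
    using assms by (intro sum_mono) (auto simp: mem_cube)
  finally show ?thesis by simp
qed

lemma norm_ge_cube:
  assumes "x \<notin> cube y l" shows "l / 2 < norm (x - y)"
proof -
  obtain i where "l / 2 < \<bar>(x - y) $ i\<bar>" using assms by (auto simp: mem_cube not_le)
  then show ?thesis using component_le_norm_cart[of "x - y" i] by linarith
qed

lemma norm_diff_le_cube:
  assumes "x \<in> cube (y :: real^'n) l" "x' \<in> cube y l"
  shows "norm (x - x') \<le> real CARD('n) * l"
  using norm_le_cube[OF assms(1)] norm_le_cube[OF assms(2)] norm_triangle_ineq4[of "x - y" "x' - y"]
  by simp

text \<open>The cubes of side \<open>3 ^ i * l\<close> exhaust the space, so a point outside one of them lies in a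
  difference of two consecutive ones; these differences play the role of annuli.\<close>

lemma ex_cube_power:
  assumes "0 < l" shows "\<exists>i. z \<in> cube y (3 ^ i * l)"
proof -
  obtain i where "2 * norm (z - y) / l < 3 ^ i"
    using real_arch_pow[of 3 "2 * norm (z - y) / l"] by auto
  then have "norm (z - y) < 3 ^ i * l / 2" using assms by (simp add: field_simps)
  then have "z \<in> cube y (3 ^ i * l)" using norm_ge_cube[of z y "3 ^ i * l"] by force
  then show ?thesis ..
qed

lemma compact_subset_cube:
  assumes "compact K" shows "\<exists>l>0. K \<subseteq> cube 0 l"
proof -
  obtain B where B: "B > 0" "\<And>x. x \<in> K \<Longrightarrow> norm x \<le> B"
    using compact_imp_bounded[OF assms] unfolding bounded_pos by auto
  have "K \<subseteq> cube 0 (2 * B)"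
    using B norm_ge_cube[of _ 0 "2 * B"] by force
  then show ?thesis using B by (intro exI[of _ "2 * B"]) auto
qed

lemma sets_cube_rel [measurable]:
  "{p. snd p \<in> cube (fst p) l} \<in> sets (borel :: ((real^'n) \<times> (real^'n)) measure)"
proof -
  have "{p. snd p \<in> cube (fst p) l} =
      (\<Inter>i. {p :: (real^'n) \<times> (real^'n). \<bar>snd p $ i - fst p $ i\<bar> \<le> l / 2})"
    by (auto simp: mem_cube)
  moreover have "closed \<dots>"
    by (intro closed_INT ballI closed_Collect_le continuous_intros)
  ultimately show ?thesis by (simp add: borel_closed)
qed

lemma measurable_indicator_cube [measurable]:
  "(\<lambda>p. indicator (cube (fst p) l) (snd p) :: 'b :: {zero_neq_one, topological_space})
     \<in> borel_measurable (borel \<Otimes>\<^sub>M (borel :: (real^'n) measure))"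
proof -
  have eq: "(\<lambda>p :: (real^'n) \<times> (real^'n). indicator (cube (fst p) l) (snd p) :: 'b) =
      indicator {p. snd p \<in> cube (fst p) l}" by (auto simp: fun_eq_iff indicator_def)
  show ?thesis unfolding eq borel_prod
    by (intro borel_measurable_indicator sets_cube_rel)
qed

section \<open>Averages of the Riesz kernel over cubes\<close>

lemma powr_neg_anti: "0 < m \<Longrightarrow> m \<le> t \<Longrightarrow> 0 \<le> a \<Longrightarrow> t powr - a \<le> m powr - (a::real)"
  by (simp add: powr_mono2')

lemma powr_neg_diff_le:
  fixes a m s t :: real
  assumes "0 < a" "0 < m" "m \<le> s" "m \<le> t"
  shows "\<bar>s powr - a - t powr - a\<bar> \<le> a * m powr (- a - 1) * \<bar>s - t\<bar>"
proof -
  have le: "\<bar>s powr - a - t powr - a\<bar> \<le> a * m powr (- a - 1) * \<bar>s - t\<bar>"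
    if st: "s < t" "m \<le> s" for s t
  proof -
    have "\<exists>z>s. z < t \<and> t powr - a - s powr - a = (t - s) * (- a * z powr (- a - 1))"
      using st assms by (intro MVT2) (auto intro!: derivative_eq_intros)
    then obtain z where z: "s < z" "z < t"
        "t powr - a - s powr - a = (t - s) * (- a * z powr (- a - 1))" by blast
    have "\<bar>s powr - a - t powr - a\<bar> = a * z powr (- a - 1) * \<bar>s - t\<bar>"
      using z st assms by (simp add: abs_mult abs_minus_commute[of "s powr - a"])
    also have "z powr (- a - 1) \<le> m powr (- a - 1)"
      using z st assms by (intro powr_mono2') auto
    finally show ?thesis using assms by (simp add: mult_left_mono mult_right_mono)
  qed
  consider "s = t" | "s < t" | "t < s" by linarith
  then show ?thesis
    by cases (use le[of s t] le[of t s] assms in \<open>auto simp: abs_minus_commute\<close>)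
qed

text \<open>The kernel is integrable at its singularity: decompose a cube around \<open>z\<close> into the shells
  between consecutive cubes of side \<open>L / 3 ^ k\<close>.\<close>

lemma nn_integral_kernel_cube_center:
  fixes z :: "real^'n"
  assumes a: "0 < a" "a < real CARD('n)" and L: "0 < L"
  shows "(\<integral>\<^sup>+x. ennreal (norm (x - z) powr - a) * indicator (cube z L) x \<partial>lborel)
    \<le> ennreal (6 powr a / (1 - 3 powr (a - real CARD('n))) * L powr (real CARD('n) - a))"
proof -
  let ?n = "real CARD('n)"
  define c where "c k = (L / (6 * 3 ^ k)) powr - a" for k :: nat
  have c: "0 \<le> c k" for k by (simp add: c_def)
  have pt: "ennreal (norm (x - z) powr - a) * indicator (cube z L) x
      \<le> (\<Sum>k. ennreal (c k) * indicator (cube z (L / 3 ^ k)) x)" for x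
  proof (cases "x \<in> cube z L \<and> x \<noteq> z")
    case True
    obtain i where i: "?n * L / norm (x - z) < 3 ^ i"
      using real_arch_pow[of 3 "?n * L / norm (x - z)"] by auto
    have "x \<notin> cube z (L / 3 ^ i)"
    proof
      assume "x \<in> cube z (L / 3 ^ i)"
      from norm_le_cube[OF this] have "norm (x - z) * 3 ^ i \<le> ?n * L / 2"
        by (simp add: field_simps)
      moreover have "?n * L < norm (x - z) * 3 ^ i" using i True by (simp add: field_simps)
      moreover have "0 < ?n * L" using L by simp
      ultimately show False by linarith
    qed
    moreover have "x \<in> cube z (L / 3 ^ 0)" using True by simp
    ultimately obtain k where k: "x \<in> cube z (L / 3 ^ k)" "x \<notin> cube z (L / 3 ^ Suc k)"
      using nat_induct[of "\<lambda>k. x \<in> cube z (L / 3 ^ k)" i] by blast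
    have "norm (x - z) powr - a \<le> c k"
      using norm_ge_cube[OF k(2)] L a unfolding c_def
      by (intro powr_neg_anti) (auto simp: field_simps)
    then have "ennreal (norm (x - z) powr - a) * indicator (cube z L) x
        \<le> ennreal (c k) * indicator (cube z (L / 3 ^ k)) x"
      using True k by (simp add: ennreal_leI)
    also have "\<dots> \<le> (\<Sum>k. ennreal (c k) * indicator (cube z (L / 3 ^ k)) x)"
      by (rule ennreal_suminf_term_le)
    finally show ?thesis .
  next
    case False
    \<comment> \<open>At the centre itself \<open>0 powr - a = 0\<close>.\<close>
    then show ?thesis using a by (auto simp: indicator_def)
  qed
  have sums: "(\<lambda>k. c k * (L / 3 ^ k) ^ CARD('n)) sums
      (6 powr a / (1 - 3 powr (a - ?n)) * L powr (?n - a))"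
  proof -
    have "c k * (L / 3 ^ k) ^ CARD('n) = 6 powr a * L powr (?n - a) * (3 powr (a - ?n)) ^ k" for k
    proof -
      have "c k = 6 powr a * (3 ^ k) powr a * L powr - a"
        using L by (simp add: c_def powr_divide powr_mult powr_minus divide_simps)
      moreover have "(L / 3 ^ k) ^ CARD('n) = L powr ?n * (3 ^ k) powr - ?n"
        using L by (simp add: power_divide powr_minus powr_realpow divide_inverse power_mult_distrib
            power_inverse)
      moreover have "(3 powr (a - ?n)) ^ k = (3 ^ k) powr a * (3 ^ k) powr - (?n :: real)"
      proof -
        have "(3 ^ k) powr b = (3 powr b) ^ k" for b :: real
        proof -
          have "(3 ^ k) powr b = (3 powr real k) powr b" by (simp add: powr_realpow)
          also have "\<dots> = 3 powr (b * real k)" by (simp only: powr_powr mult.commute)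
          also have "\<dots> = (3 powr b) ^ k" by (simp add: powr_power mult.commute)
          finally show ?thesis .
        qed
        moreover have "(3 powr (a - ?n)) ^ k = (3 powr a) ^ k * (3 powr - ?n) ^ k"
          by (simp flip: power_mult_distrib powr_add)
        ultimately show ?thesis by metis
      qed
      moreover have "L powr (?n - a) = L powr ?n * L powr - a"
        by (simp add: powr_add[symmetric])
      ultimately show ?thesis by (simp only: mult_ac)
    qed
    moreover have "(\<lambda>k. 6 powr a * L powr (?n - a) * (3 powr (a - ?n)) ^ k) sums
      (6 powr a * L powr (?n - a) * (1 / (1 - 3 powr (a - ?n))))"
      using a by (intro sums_mult geometric_sums) (simp add: powr_less_one)
    ultimately show ?thesis by (simp add: mult_ac)
  qed
  have "(\<integral>\<^sup>+x. ennreal (norm (x - z) powr - a) * indicator (cube z L) x \<partial>lborel)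
      \<le> (\<integral>\<^sup>+x. (\<Sum>k. ennreal (c k) * indicator (cube z (L / 3 ^ k)) x) \<partial>lborel)"
    by (intro nn_integral_mono pt)
  also have "\<dots> = (\<Sum>k. \<integral>\<^sup>+x. ennreal (c k) * indicator (cube z (L / 3 ^ k)) x \<partial>lborel)"
    by (intro nn_integral_suminf) measurable
  also have "\<dots> = (\<Sum>k. ennreal (c k * (L / 3 ^ k) ^ CARD('n)))"
    using L c by (simp add: nn_integral_cmult emeasure_cube ennreal_mult)
  also have "\<dots> = ennreal (6 powr a / (1 - 3 powr (a - ?n)) * L powr (?n - a))"
    using L c sums by (intro suminf_ennreal_eq) auto
  finally show ?thesis .
qed

text \<open>The centre \<open>z\<close> of the singularity may be any point near the cube, since then the cube is
  contained in a cube around \<open>z\<close> of comparable side.\<close>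

lemma nn_integral_kernel_cube:
  fixes y :: "real^'n"
  assumes a: "0 < a" "a < real CARD('n)"
  obtains A where "0 \<le> A" and "\<And>y z :: real^'n. \<And>l. 0 < l \<Longrightarrow> z \<in> cube y (3 * l) \<Longrightarrow>
    (\<integral>\<^sup>+x\<in>cube y l. ennreal (norm (x - z) powr - a) \<partial>lborel)
      \<le> ennreal (A * (l powr - a * l ^ CARD('n)))"
proof -
  let ?n = "real CARD('n)"
  define A where "A = 6 powr a / (1 - 3 powr (a - ?n)) * 4 powr (?n - a)"
  have "3 powr (a - ?n) < 1" using a by (simp add: powr_less_one)
  then have "0 \<le> A" by (simp add: A_def)
  moreover have "(\<integral>\<^sup>+x\<in>cube y l. ennreal (norm (x - z) powr - a) \<partial>lborel)
      \<le> ennreal (A * (l powr - a * l ^ CARD('n)))" if l: "0 < l" and z: "z \<in> cube y (3 * l)"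
          for y z :: "real^'n" and l
  proof -
    have "cube y l \<subseteq> cube z (4 * l)"
      using cube_trans[of y z "3 * l" _ l] z by (auto simp: cube_commute)
    then have "(\<integral>\<^sup>+x\<in>cube y l. ennreal (norm (x - z) powr - a) \<partial>lborel)
        \<le> (\<integral>\<^sup>+x\<in>cube z (4 * l). ennreal (norm (x - z) powr - a) \<partial>lborel)"
      by (intro nn_integral_mono mult_left_mono) (auto simp: indicator_def)
    also have "\<dots> \<le> ennreal (6 powr a / (1 - 3 powr (a - ?n)) * (4 * l) powr (?n - a))"
      using l by (intro nn_integral_kernel_cube_center a) auto
    also have "\<dots> = ennreal (A * (l powr - a * l ^ CARD('n)))"
      using l by (simp add: A_def powr_mult powr_diff powr_minus powr_realpow divide_inverse mult_ac)
    finally show ?thesis .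
  qed
  ultimately show ?thesis by (rule that)
qed

text \<open>The smoothness of the kernel. Averaged over two points of \<open>cube y l\<close>, the difference of
  kernels gains a factor \<open>l / \<bar>z - y\<bar>\<close> over the kernel itself when \<open>z\<close> is far away, by the mean
  value theorem; when \<open>z\<close> is close, the two kernels are estimated separately.\<close>

lemma nn_integral_kernel_diff:
  assumes a: "0 < a" "a < real CARD('n)"
  obtains C where "0 \<le> C" and "\<And>y z :: real^'n. \<And>l. 0 < l \<Longrightarrow>
    (\<integral>\<^sup>+x\<in>cube y l. (\<integral>\<^sup>+x'\<in>cube y l.
        ennreal \<bar>norm (x - z) powr - a - norm (x' - z) powr - a\<bar> \<partial>lborel) \<partial>lborel)
      \<le> ennreal (C * (l ^ CARD('n))\<^sup>2) *
         (\<Sum>i. ennreal ((1 / 3) ^ Suc i * (3 ^ Suc i * l) powr - a) * indicator (cube y (3 ^ Suc i * l)) z)"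
proof -
  let ?n = "real CARD('n)"
  obtain A where A: "0 \<le> A" "\<And>y z :: real^'n. \<And>l. 0 < l \<Longrightarrow> z \<in> cube y (3 * l) \<Longrightarrow>
    (\<integral>\<^sup>+x\<in>cube y l. ennreal (norm (x - z) powr - a) \<partial>lborel)
      \<le> ennreal (A * (l powr - a * l ^ CARD('n)))"
    using nn_integral_kernel_cube[OF a] by blast
  define C where "C = max (2 * A * 3 powr (a + 1)) (a * ?n * 9 powr (a + 1))"
  have C: "0 \<le> C" using A a by (simp add: C_def le_max_iff_disj)
  have "(\<integral>\<^sup>+x\<in>cube y l. (\<integral>\<^sup>+x'\<in>cube y l.
        ennreal \<bar>norm (x - z) powr - a - norm (x' - z) powr - a\<bar> \<partial>lborel) \<partial>lborel)
      \<le> ennreal (C * (l ^ CARD('n))\<^sup>2) *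
         (\<Sum>i. ennreal ((1 / 3) ^ Suc i * (3 ^ Suc i * l) powr - a) * indicator (cube y (3 ^ Suc i * l)) z)"
    (is "?I \<le> ennreal ?D * (\<Sum>i. ?t i)") if l: "0 < l" for y z :: "real^'n" and l
  proof -
    have em: "emeasure lborel (cube y l) = ennreal (l ^ CARD('n))"
      using l by (rule emeasure_cube)
    have D: "0 \<le> ?D" using C by simp
    show ?thesis
    proof (cases "z \<in> cube y (3 * l)")
      case True
      let ?k = "\<lambda>x. ennreal (norm (x - z) powr - a)"
      define J where "J = (\<integral>\<^sup>+x\<in>cube y l. ?k x \<partial>lborel)"
      have "?I \<le> (\<integral>\<^sup>+x\<in>cube y l. (\<integral>\<^sup>+x'\<in>cube y l. ?k x + ?k x' \<partial>lborel) \<partial>lborel)"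
      proof -
        have "\<bar>u - v\<bar> \<le> u + v" if "0 \<le> u" "0 \<le> v" for u v :: real using that by linarith
        then show ?thesis
          by (intro nn_integral_mono mult_right_mono)
             (auto simp: ennreal_plus[symmetric] simp del: ennreal_plus intro!: ennreal_leI)
      qed
      also have "\<dots> = (\<integral>\<^sup>+x\<in>cube y l. (?k x * ennreal (l ^ CARD('n)) + J) \<partial>lborel)"
        by (simp add: distrib_right nn_integral_add nn_integral_cmult em J_def)
      also have "\<dots> = ennreal (l ^ CARD('n)) * J + J * ennreal (l ^ CARD('n))"
      proof -
        have "(\<integral>\<^sup>+x\<in>cube y l. (?k x * ennreal (l ^ CARD('n)) + J) \<partial>lborel) =
            (\<integral>\<^sup>+x. ennreal (l ^ CARD('n)) * (?k x * indicator (cube y l) x) + J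
                * indicator (cube y l) x \<partial>lborel)"
          by (simp add: algebra_simps)
        also have "\<dots> = ennreal (l ^ CARD('n)) * J + J * ennreal (l ^ CARD('n))"
          by (subst nn_integral_add, measurable, simp add: nn_integral_cmult em, simp add: J_def)
        finally show ?thesis .
      qed
      also have "\<dots> \<le> ennreal (2 * (A * (l powr - a * l ^ CARD('n))) * l ^ CARD('n))"
      proof -
        have "J \<le> ennreal (A * (l powr - a * l ^ CARD('n)))" unfolding J_def by (intro A l True)
        then have "ennreal (l ^ CARD('n)) * J + J * ennreal (l ^ CARD('n))
          \<le> ennreal (l ^ CARD('n)) * ennreal (A * (l powr - a * l ^ CARD('n))) + ennreal (A
              * (l powr - a * l ^ CARD('n))) * ennreal (l ^ CARD('n))"
          by (intro add_mono mult_mono) auto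
        also have "\<dots> = ennreal (2 * (A * (l powr - a * l ^ CARD('n))) * l ^ CARD('n))"
          using A l by (simp add: ennreal_mult[symmetric] ennreal_plus[symmetric] mult_ac del: ennreal_plus)
        finally show ?thesis .
      qed
      also have "\<dots> \<le> ennreal (?D * ((1 / 3) ^ Suc 0 * (3 ^ Suc 0 * l) powr - a))"
      proof (intro ennreal_leI)
        have "2 * (A * (l powr - a * l ^ CARD('n))) * l ^ CARD('n)
            = (2 * A * 3 powr (a + 1)) * (l ^ CARD('n))\<^sup>2 * ((1 / 3) ^ Suc 0 * (3 ^ Suc 0 * l) powr - a)"
          using l by (simp add: powr_mult powr_add powr_minus power2_eq_square divide_simps)
        also have "\<dots> \<le> ?D * ((1 / 3) ^ Suc 0 * (3 ^ Suc 0 * l) powr - a)"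
          using l by (intro mult_right_mono) (auto simp: C_def)
        finally show "2 * (A * (l powr - a * l ^ CARD('n))) * l ^ CARD('n)
            \<le> ?D * ((1 / 3) ^ Suc 0 * (3 ^ Suc 0 * l) powr - a)" .
      qed
      also have "\<dots> = ennreal ?D * ?t 0"
        using True l D by (subst ennreal_mult) auto
      also have "\<dots> \<le> ennreal ?D * (\<Sum>i. ?t i)"
        by (intro mult_left_mono ennreal_suminf_term_le) auto
      finally show ?thesis .
    next
      case False
      obtain j where j: "z \<in> cube y (3 ^ j * l)" using ex_cube_power[OF l] by blast
      obtain i where i: "z \<notin> cube y (3 ^ Suc i * l)" "z \<in> cube y (3 ^ Suc (Suc i) * l)"
      proof -
        have "z \<notin> cube y (3 ^ Suc 0 * l)" using False by simp
        moreover have "z \<in> cube y (3 ^ Suc j * l)"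
          using j cube_mono[of "3 ^ j * l" "3 ^ Suc j * l" y] l by auto
        ultimately show thesis
          using nat_induct[of "\<lambda>i. z \<notin> cube y (3 ^ Suc i * l)" j] that by blast
      qed
      define m where "m = 3 ^ i * l"
      have m: "0 < m" using l by (simp add: m_def)
      have far: "m \<le> norm (x - z)" if "x \<in> cube y l" for x
      proof -
        have "z \<notin> cube x (2 * m)"
        proof
          assume "z \<in> cube x (2 * m)"
          then have in_Q: "z \<in> cube y (l + 2 * m)" using that by (rule cube_trans[rotated])
          have "l \<le> m" using l by (simp add: m_def)
          moreover have "3 ^ Suc i * l = 3 * m" by (simp add: m_def)
          ultimately have "l + 2 * m \<le> 3 ^ Suc i * l" by linarith
          with in_Q show False using i(1) cube_mono by blast
        qed
        from norm_ge_cube[OF this] show ?thesis by (simp add: norm_minus_commute)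
      qed
      define M where "M = a * m powr (- a - 1) * (?n * l)"
      have M: "0 \<le> M" using a l by (simp add: M_def)
      have pt: "\<bar>norm (x - z) powr - a - norm (x' - z) powr - a\<bar> \<le> M"
        if x: "x \<in> cube y l" "x' \<in> cube y l" for x x'
      proof -
        have "\<bar>norm (x - z) - norm (x' - z)\<bar> \<le> norm (x - x')"
          using norm_triangle_ineq3[of "x - z" "x' - z"] by simp
        also have "\<dots> \<le> ?n * l" using x by (rule norm_diff_le_cube)
        finally have "a * m powr (- a - 1) * \<bar>norm (x - z) - norm (x' - z)\<bar> \<le> M"
          unfolding M_def using a by (intro mult_left_mono) auto
        with powr_neg_diff_le[OF a(1) m far[OF x(1)] far[OF x(2)]] show ?thesis by linarith
      qed
      have "?I \<le> (\<integral>\<^sup>+x\<in>cube y l. (\<integral>\<^sup>+x'\<in>cube y l. ennreal M \<partial>lborel) \<partial>lborel)"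
        using pt by (intro nn_integral_mono) (auto simp: indicator_def intro!: nn_integral_mono ennreal_leI)
      also have "\<dots> = ennreal (M * (l ^ CARD('n))\<^sup>2)"
        using M l by (simp add: nn_integral_cmult em ennreal_mult power2_eq_square mult_ac)
      also have "\<dots> \<le> ennreal (?D * ((1 / 3) ^ Suc (Suc i) * (3 ^ Suc (Suc i) * l) powr - a))"
      proof (intro ennreal_leI)
        have "M = (a * ?n * 9 powr (a + 1)) * ((1 / 3) ^ Suc (Suc i) * (3 ^ Suc (Suc i) * l) powr - a)"
        proof -
          have e1: "3 ^ Suc (Suc i) * l = 9 * m" by (simp add: m_def)
          have e2: "(1 / 3) ^ Suc (Suc i) = l / (9 * m)"
            using l by (simp add: m_def power_divide)
          have e3: "m powr (- a - 1) = m powr - a / m"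
            using m by (simp add: powr_diff)
          have e4: "(9 * m) powr - a = m powr - a / 9 powr a"
            using m by (simp add: powr_mult powr_minus divide_simps)
          show ?thesis unfolding M_def e1 e2 e3 e4 using m by (simp add: powr_add)
        qed
        then have "M * (l ^ CARD('n))\<^sup>2 = (a * ?n * 9 powr (a + 1)) * (l ^ CARD('n))\<^sup>2
            * ((1 / 3) ^ Suc (Suc i) * (3 ^ Suc (Suc i) * l) powr - a)"
          by (simp only: mult_ac)
        also have "\<dots> \<le> ?D * ((1 / 3) ^ Suc (Suc i) * (3 ^ Suc (Suc i) * l) powr - a)"
          using l by (intro mult_right_mono) (auto simp: C_def)
        finally show "M * (l ^ CARD('n))\<^sup>2 \<le> ?D * ((1 / 3) ^ Suc (Suc i) * (3 ^ Suc (Suc i) * l) powr - a)" .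
      qed
      also have "\<dots> = ennreal ?D * ?t (Suc i)"
        using i l D by (subst ennreal_mult) auto
      also have "\<dots> \<le> ennreal ?D * (\<Sum>i. ?t i)"
        by (intro mult_left_mono ennreal_suminf_term_le) auto
      finally show ?thesis .
    qed
  qed
  with C show ?thesis by (rule that)
qed

section \<open>Local integrability of Riesz potentials\<close>

lemma riesz_integrand_eq:
  "riesz_integrand \<gamma> f x z = (norm (x - z) powr - (real CARD('n) - \<gamma>)) *\<^sub>R f (z :: real^'n)"
  by (simp only: riesz_integrand_def powr_minus)

lemma measurable_kernel [measurable]:
  "(\<lambda>p. norm (fst p - snd p) powr a) \<in> borel_measurable (borel \<Otimes>\<^sub>M (borel :: (real^'n) measure))"
  by measurable

lemma measurable_riesz_integrand [measurable]:
  fixes f :: "real^'n \<Rightarrow> complex"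
  assumes [measurable]: "f \<in> borel_measurable borel"
  shows "(\<lambda>p. riesz_integrand \<gamma> f (fst p) (snd p)) \<in> borel_measurable (borel \<Otimes>\<^sub>M borel)"
  unfolding riesz_integrand_eq by measurable

lemma measurable_riesz_integrand' [measurable]:
  fixes f :: "real^'n \<Rightarrow> complex"
  assumes [measurable]: "f \<in> borel_measurable borel"
  shows "riesz_integrand \<gamma> f x \<in> borel_measurable borel"
  unfolding riesz_integrand_eq[abs_def] by measurable

lemma frac_integral_lborel:
  fixes f :: "real^'n \<Rightarrow> complex"
  assumes [measurable]: "f \<in> borel_measurable borel"
  shows "frac_integral \<gamma> f x =
    (1 / riesz_const (real CARD('n)) \<gamma>) *\<^sub>R (LINT z|lborel. riesz_integrand \<gamma> f x z)"
  unfolding frac_integral_def by (subst integral_completion) auto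

lemma measurable_frac_integral [measurable]:
  fixes f :: "real^'n \<Rightarrow> complex"
  assumes [measurable]: "f \<in> borel_measurable borel"
  shows "frac_integral \<gamma> f \<in> borel_measurable borel"
proof -
  have "(\<lambda>x. LINT z|lborel. riesz_integrand \<gamma> f x z) \<in> borel_measurable borel"
    by (rule lborel.borel_measurable_lebesgue_integral) (simp add: case_prod_beta)
  then show ?thesis by (simp add: frac_integral_lborel[OF assms, abs_def])
qed

lemma integrable_riesz_integrand_lborel:
  fixes f :: "real^'n \<Rightarrow> complex"
  assumes [measurable]: "f \<in> borel_measurable borel"
  shows "integrable lebesgue (riesz_integrand \<gamma> f x) \<longleftrightarrow> integrable lborel (riesz_integrand \<gamma> f x)"
  by (rule integrable_completion) auto

text \<open>Integrated over a cube around the origin, the kernel loses its singularity and keeps its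
  decay.\<close>

lemma nn_integral_kernel_cube_tail:
  fixes l :: real
  assumes a: "0 < a" "a < real CARD('n)" and l: "0 < l"
  obtains B where "0 \<le> B" and "\<And>z :: real^'n.
    (\<integral>\<^sup>+x\<in>cube 0 l. ennreal (norm (x - z) powr - a) \<partial>lborel) \<le> ennreal (B * (1 + norm z) powr - a)"
proof -
  let ?n = "real CARD('n)"
  obtain A where A: "0 \<le> A" "\<And>y z :: real^'n. \<And>l. 0 < l \<Longrightarrow> z \<in> cube y (3 * l) \<Longrightarrow>
    (\<integral>\<^sup>+x\<in>cube y l. ennreal (norm (x - z) powr - a) \<partial>lborel)
      \<le> ennreal (A * (l powr - a * l ^ CARD('n)))"
    using nn_integral_kernel_cube[OF a] by blast
  define A' where "A' = A * (l powr - a * l ^ CARD('n))"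
  define \<rho> \<kappa> where "\<rho> = 1 + ?n * (3 * l / 2)" and "\<kappa> = (1 + ?n * (l / 2)) / l + 1"
  have pos: "0 \<le> A'" "0 < \<rho>" "0 < \<kappa>"
    using A l by (auto simp: A'_def \<rho>_def \<kappa>_def add_pos_nonneg)
  define B where "B = A' * \<rho> powr a + \<kappa> powr a * l ^ CARD('n)"
  have "(\<integral>\<^sup>+x\<in>cube 0 l. ennreal (norm (x - z) powr - a) \<partial>lborel) \<le> ennreal (B * (1 + norm z) powr - a)"
    for z :: "real^'n"
  proof (cases "z \<in> cube 0 (3 * l)")
    case True
    have "(\<integral>\<^sup>+x\<in>cube 0 l. ennreal (norm (x - z) powr - a) \<partial>lborel) \<le> ennreal A'"
      unfolding A'_def by (intro A l True)
    also have "\<dots> \<le> ennreal (B * (1 + norm z) powr - a)"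
    proof (intro ennreal_leI)
      have "\<rho> powr - a \<le> (1 + norm z) powr - a"
        using norm_le_cube[OF True] a
        by (intro powr_neg_anti) (auto simp: \<rho>_def add_pos_nonneg)
      then have "1 \<le> \<rho> powr a * (1 + norm z) powr - a"
        using pos by (simp add: powr_minus field_simps)
      then have "A' \<le> A' * (\<rho> powr a * (1 + norm z) powr - a)"
        using pos mult_left_mono[of 1 _ A'] by simp
      also have "\<dots> \<le> B * (1 + norm z) powr - a"
        using l by (simp add: B_def distrib_right)
      finally show "A' \<le> B * (1 + norm z) powr - a" .
    qed
    finally show ?thesis .
  next
    case False
    have pt: "norm (x - z) powr - a \<le> \<kappa> powr a * (1 + norm z) powr - a" if x: "x \<in> cube 0 l" for x :: "real^'n"
    proof -
      have "z \<notin> cube x (2 * l)"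
        using False cube_trans[OF x, of z "2 * l"] by auto
      then have far: "l \<le> norm (x - z)"
        using norm_ge_cube[of z x "2 * l"] by (simp add: norm_minus_commute)
      have "1 + norm z \<le> 1 + norm x + norm (x - z)"
        using norm_triangle_ineq4[of x "x - z"] by simp
      also have "\<dots> \<le> (1 + ?n * (l / 2)) + norm (x - z)"
        using norm_le_cube[OF x] by simp
      also have "1 + ?n * (l / 2) \<le> ((1 + ?n * (l / 2)) / l) * norm (x - z)"
        using far l by (simp add: field_simps mult_left_mono add_mono)
      finally have "1 + norm z \<le> \<kappa> * norm (x - z)" by (simp add: \<kappa>_def distrib_right)
      then have "(\<kappa> * norm (x - z)) powr - a \<le> (1 + norm z) powr - a"
        using a by (intro powr_neg_anti) (auto simp: add_pos_nonneg)
      then have "\<kappa> powr a * (\<kappa> * norm (x - z)) powr - a \<le> \<kappa> powr a * (1 + norm z) powr - a"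
        by (intro mult_left_mono) auto
      moreover have "\<kappa> powr a * (\<kappa> * norm (x - z)) powr - a = norm (x - z) powr - a"
        using pos by (simp add: powr_mult powr_minus)
      ultimately show ?thesis by simp
    qed
    have "(\<integral>\<^sup>+x\<in>cube 0 l. ennreal (norm (x - z) powr - a) \<partial>lborel)
        \<le> (\<integral>\<^sup>+x\<in>cube (0 :: real^'n) l. ennreal (\<kappa> powr a * (1 + norm z) powr - a) \<partial>lborel)"
      using pt by (intro nn_integral_mono) (auto simp: indicator_def intro!: ennreal_leI)
    also have "\<dots> = ennreal (\<kappa> powr a * l ^ CARD('n) * (1 + norm z) powr - a)"
      using l by (simp add: nn_integral_cmult emeasure_cube ennreal_mult[symmetric])
    also have "\<dots> \<le> ennreal (B * (1 + norm z) powr - a)"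
      using pos by (intro ennreal_leI) (simp add: B_def distrib_right)
    finally show ?thesis .
  qed
  moreover have "0 \<le> B" using pos l by (simp add: B_def)
  ultimately show ?thesis using that by blast
qed

text \<open>The condition on \<open>f\<close> under which its Riesz potential with kernel \<open>\<bar>x - z\<bar> powr - a\<close>
  converges absolutely at almost every point. It holds as soon as the potential converges
  absolutely at one point (\<open>finite_tail_if_integrable\<close>), and then the potential converges
  absolutely almost everywhere to a locally integrable function (\<open>potential_cube_finite\<close>).\<close>
definition finite_tail :: "real \<Rightarrow> (real^'n \<Rightarrow> complex) \<Rightarrow> bool" where
  "finite_tail a f \<longleftrightarrow> (\<integral>\<^sup>+z. ennreal (norm (f z)) * ennreal ((1 + norm z) powr - a) \<partial>lborel) < \<infinity>"

lemma norm_riesz_integrand: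
  "ennreal (norm (riesz_integrand \<gamma> f x z)) =
    ennreal (norm (x - z) powr - (real CARD('n) - \<gamma>)) * ennreal (norm (f (z :: real^'n)))"
  by (simp add: riesz_integrand_eq ennreal_mult)

lemma finite_tail_if_integrable:
  fixes f :: "real^'n \<Rightarrow> complex"
  assumes [measurable]: "f \<in> borel_measurable borel" and "\<gamma> < real CARD('n)"
    and int: "integrable lborel (riesz_integrand \<gamma> f x)"
  shows "finite_tail (real CARD('n) - \<gamma>) f"
proof -
  define a where "a = real CARD('n) - \<gamma>"
  have a: "0 < a" using assms by (simp add: a_def)
  \<comment> \<open>The point \<open>z = x\<close> is excluded because \<open>0 powr - a = 0\<close>; it is a null set.\<close>
  have pt: "ennreal (norm (f z)) * ennreal ((1 + norm z) powr - a)
      \<le> ennreal ((1 + norm x) powr a) * ennreal (norm (riesz_integrand \<gamma> f x z))" if "z \<noteq> x" for z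
  proof -
    have "norm (x - z) \<le> norm x + norm z" by (rule norm_triangle_ineq4)
    also have "\<dots> \<le> (1 + norm x) * (1 + norm z)" by (simp add: algebra_simps)
    finally have "((1 + norm x) * (1 + norm z)) powr - a \<le> norm (x - z) powr - a"
      using that a by (intro powr_neg_anti) auto
    then have "(1 + norm x) powr a * ((1 + norm x) * (1 + norm z)) powr - a \<le> (1 + norm x) powr a
        * norm (x - z) powr - a"
      by (intro mult_left_mono) auto
    moreover have "(1 + norm x) powr a * ((1 + norm x) * (1 + norm z)) powr - a = (1 + norm z) powr - a"
    proof -
      have "1 + norm x \<noteq> 0" using norm_ge_zero[of x] by linarith
      then show ?thesis by (simp add: powr_mult powr_minus)
    qed
    ultimately have "(1 + norm z) powr - a \<le> (1 + norm x) powr a * norm (x - z) powr - a" by simp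
    then have "norm (f z) * (1 + norm z) powr - a \<le> norm (f z) * ((1 + norm x) powr a * norm (x - z) powr - a)"
      by (intro mult_left_mono) auto
    then show ?thesis
      by (simp add: norm_riesz_integrand a_def[symmetric] ennreal_mult[symmetric] mult_ac ennreal_leI)
  qed
  have "(\<integral>\<^sup>+z. ennreal (norm (f z)) * ennreal ((1 + norm z) powr - a) \<partial>lborel)
      \<le> (\<integral>\<^sup>+z. ennreal ((1 + norm x) powr a) * ennreal (norm (riesz_integrand \<gamma> f x z)) \<partial>lborel)"
    using AE_lborel_singleton[of x] by (intro nn_integral_mono_AE) (auto intro: pt elim!: eventually_mono)
  also have "\<dots> = ennreal ((1 + norm x) powr a) * (\<integral>\<^sup>+z. ennreal (norm (riesz_integrand \<gamma> f x z)) \<partial>lborel)"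
    by (intro nn_integral_cmult) measurable
  also have "\<dots> < \<infinity>"
    using int by (auto simp: integrable_iff_bounded ennreal_mult_less_top)
  finally show ?thesis by (simp add: finite_tail_def a_def)
qed

lemma potential_cube_finite:
  fixes f :: "real^'n \<Rightarrow> complex"
  assumes [measurable]: "f \<in> borel_measurable borel"
    and \<gamma>: "0 < \<gamma>" "\<gamma> < real CARD('n)" and l: "0 < l" and tail: "finite_tail (real CARD('n) - \<gamma>) f"
  shows "(\<integral>\<^sup>+x\<in>cube 0 l. (\<integral>\<^sup>+z. ennreal (norm (riesz_integrand \<gamma> f x z)) \<partial>lborel) \<partial>lborel) < \<infinity>"
proof -
  define a where "a = real CARD('n) - \<gamma>"
  have a: "0 < a" "a < real CARD('n)" using \<gamma> by (auto simp: a_def)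
  obtain B where B: "0 \<le> B" "\<And>z :: real^'n.
    (\<integral>\<^sup>+x\<in>cube 0 l. ennreal (norm (x - z) powr - a) \<partial>lborel) \<le> ennreal (B * (1 + norm z) powr - a)"
    using nn_integral_kernel_cube_tail[OF a l] by blast
  have "(\<integral>\<^sup>+x\<in>cube 0 l. (\<integral>\<^sup>+z. ennreal (norm (riesz_integrand \<gamma> f x z)) \<partial>lborel) \<partial>lborel)
      = (\<integral>\<^sup>+x. (\<integral>\<^sup>+z. ennreal (norm (f z)) * (ennreal (norm (x - z) powr - a)
          * indicator (cube 0 l) x) \<partial>lborel) \<partial>lborel)"
    unfolding norm_riesz_integrand a_def[symmetric]
    by (intro nn_integral_cong, subst nn_integral_multc[symmetric]) (auto simp: mult_ac)
  also have "\<dots> = (\<integral>\<^sup>+z. (\<integral>\<^sup>+x. ennreal (norm (f z)) * (ennreal (norm (x - z) powr - a)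
      * indicator (cube 0 l) x) \<partial>lborel) \<partial>lborel)"
    by (intro lborel_pair.Fubini') (simp add: case_prod_beta)
  also have "\<dots> = (\<integral>\<^sup>+z. ennreal (norm (f z)) * (\<integral>\<^sup>+x\<in>cube 0 l. ennreal (norm (x - z) powr - a)
      \<partial>lborel) \<partial>lborel)"
    by (simp add: nn_integral_cmult)
  also have "\<dots> \<le> (\<integral>\<^sup>+z. ennreal B * (ennreal (norm (f z)) * ennreal ((1 + norm z) powr - a)) \<partial>lborel)"
  proof (intro nn_integral_mono)
    fix z :: "real^'n"
    have "ennreal (norm (f z)) * (\<integral>\<^sup>+x\<in>cube 0 l. ennreal (norm (x - z) powr - a) \<partial>lborel)
        \<le> ennreal (norm (f z)) * ennreal (B * (1 + norm z) powr - a)"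
      by (intro mult_left_mono B) auto
    then show "ennreal (norm (f z)) * (\<integral>\<^sup>+x\<in>cube 0 l. ennreal (norm (x - z) powr - a) \<partial>lborel)
        \<le> ennreal B * (ennreal (norm (f z)) * ennreal ((1 + norm z) powr - a))"
      using B by (simp add: ennreal_mult mult_ac)
  qed
  also have "\<dots> = ennreal B * (\<integral>\<^sup>+z. ennreal (norm (f z)) * ennreal ((1 + norm z) powr - a) \<partial>lborel)"
    by (intro nn_integral_cmult) measurable
  also have "\<dots> < \<infinity>"
    using tail by (simp add: finite_tail_def a_def ennreal_mult_less_top)
  finally show ?thesis .
qed

lemma AE_integrable_riesz_integrand:
  fixes f :: "real^'n \<Rightarrow> complex"
  assumes [measurable]: "f \<in> borel_measurable borel"
    and \<gamma>: "0 < \<gamma>" "\<gamma> < real CARD('n)" and tail: "finite_tail (real CARD('n) - \<gamma>) f"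
  shows "AE x in lborel. integrable lborel (riesz_integrand \<gamma> f x)"
proof -
  have "AE x in lborel. \<forall>k::nat. x \<in> cube 0 (real (Suc k)) \<longrightarrow> integrable lborel (riesz_integrand \<gamma> f x)"
    unfolding AE_all_countable
  proof
    fix k
    have "(\<integral>\<^sup>+x\<in>cube 0 (real (Suc k)). (\<integral>\<^sup>+z. ennreal (norm (riesz_integrand \<gamma> f x z)) \<partial>lborel) \<partial>lborel) \<noteq> \<infinity>"
      using potential_cube_finite[OF assms(1) \<gamma> _ tail, of "real (Suc k)"] by simp
    then have "AE x in lborel. (\<integral>\<^sup>+z. ennreal (norm (riesz_integrand \<gamma> f x z)) \<partial>lborel)
        * indicator (cube 0 (real (Suc k))) x \<noteq> \<infinity>"
      by (intro nn_integral_PInf_AE) measurable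
    then show "AE x in lborel. x \<in> cube 0 (real (Suc k)) \<longrightarrow> integrable lborel (riesz_integrand \<gamma> f x)"
      by eventually_elim (auto simp: integrable_iff_bounded less_top)
  qed
  moreover have "\<exists>k::nat. x \<in> cube 0 (real (Suc k))" for x :: "real^'n"
  proof -
    obtain l where "0 < l" "{x} \<subseteq> cube 0 l" using compact_subset_cube[of "{x}"] by auto
    moreover have "l \<le> real (Suc (nat \<lceil>l\<rceil>))" by linarith
    ultimately show ?thesis using cube_mono by blast
  qed
  ultimately show ?thesis by (auto elim!: eventually_mono)
qed

text \<open>No assumption on \<open>f\<close> besides measurability is needed: without \<open>finite_tail\<close> the defining
  integral diverges at every point, and \<open>frac_integral \<gamma> f\<close> is the zero function.\<close>

lemma locally_integrable_frac_integral_borel: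
  fixes f :: "real^'n \<Rightarrow> complex"
  assumes [measurable]: "f \<in> borel_measurable borel"
    and \<gamma>: "0 < \<gamma>" "\<gamma> < real CARD('n)"
  shows "locally_integrable (frac_integral \<gamma> f)"
proof (cases "finite_tail (real CARD('n) - \<gamma>) f")
  case True
  let ?c = "1 / riesz_const (real CARD('n)) \<gamma>"
  have "set_integrable lebesgue (cube 0 l) (frac_integral \<gamma> f)" if l: "0 < l" for l
  proof -
    have "set_integrable lborel (cube 0 l) (frac_integral \<gamma> f)"
      unfolding set_integrable_def integrable_iff_bounded
    proof
      have "(\<integral>\<^sup>+x. ennreal (norm (indicator (cube 0 l) x *\<^sub>R frac_integral \<gamma> f x)) \<partial>lborel)
          \<le> (\<integral>\<^sup>+x. ennreal \<bar>?c\<bar> * ((\<integral>\<^sup>+z. ennreal (norm (riesz_integrand \<gamma> f x z)) \<partial>lborel)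
              * indicator (cube 0 l) x) \<partial>lborel)"
      proof (rule nn_integral_mono)
        fix x
        have "ennreal (norm (LINT z|lborel. riesz_integrand \<gamma> f x z))
            \<le> (\<integral>\<^sup>+z. ennreal (norm (riesz_integrand \<gamma> f x z)) \<partial>lborel)"
          by (cases "integrable lborel (riesz_integrand \<gamma> f x)")
             (auto intro: integral_norm_bound_ennreal simp: not_integrable_integral_eq)
        then have "ennreal \<bar>?c\<bar> * ennreal (norm (LINT z|lborel. riesz_integrand \<gamma> f x z))
            \<le> ennreal \<bar>?c\<bar> * (\<integral>\<^sup>+z. ennreal (norm (riesz_integrand \<gamma> f x z)) \<partial>lborel)"
          by (rule mult_left_mono) simp
        then show "ennreal (norm (indicator (cube 0 l) x *\<^sub>R frac_integral \<gamma> f x))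
            \<le> ennreal \<bar>?c\<bar> * ((\<integral>\<^sup>+z. ennreal (norm (riesz_integrand \<gamma> f x z)) \<partial>lborel)
                * indicator (cube 0 l) x)"
          by (simp add: frac_integral_lborel indicator_def ennreal_mult[symmetric])
      qed
      also have "\<dots> = ennreal \<bar>?c\<bar> * (\<integral>\<^sup>+x\<in>cube 0 l. (\<integral>\<^sup>+z. ennreal (norm (riesz_integrand \<gamma> f x z))
          \<partial>lborel) \<partial>lborel)"
        by (intro nn_integral_cmult) measurable
      also have "\<dots> < \<infinity>"
        using potential_cube_finite[OF assms(1) \<gamma> l True] by (simp add: ennreal_mult_less_top)
      finally show "(\<integral>\<^sup>+x. ennreal (norm (indicator (cube 0 l) x *\<^sub>R frac_integral \<gamma> f x)) \<partial>lborel) < \<infinity>" .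
    qed measurable
    then show ?thesis unfolding set_integrable_def by (subst integrable_completion) auto
  qed
  then show ?thesis
    unfolding locally_integrable_def using compact_subset_cube
    by (metis set_integrable_subset lmeasurable_compact fmeasurableD)
next
  case False
  then have "\<not> integrable lborel (riesz_integrand \<gamma> f x)" for x
    using finite_tail_if_integrable[OF assms(1) \<gamma>(2)] by blast
  then have "frac_integral \<gamma> f x = 0" for x
    by (simp add: frac_integral_lborel not_integrable_integral_eq)
  then have "frac_integral \<gamma> f = (\<lambda>x. 0)" by auto
  then show ?thesis by (simp add: locally_integrable_def set_integrable_def)
qed

section \<open>Mean oscillation of Riesz potentials\<close>

text \<open>The fractional average of \<open>\<bar>f\<bar>\<close> over a cube, normalised by the power \<open>L powr - a\<close> of the
  side. It is always used with \<open>a = n - \<gamma>\<close>, where it is the size of the part of the Riesz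
  potential of order \<open>\<gamma>\<close> that comes from the mass of \<open>f\<close> at distance about \<open>L\<close>.\<close>
definition scaled_mass :: "real \<Rightarrow> (real^'n \<Rightarrow> complex) \<Rightarrow> real^'n \<Rightarrow> real \<Rightarrow> ennreal" where
  "scaled_mass a f y L = ennreal (L powr - a) * (\<integral>\<^sup>+z\<in>cube y L. ennreal (norm (f z)) \<partial>lebesgue)"

lemma scaled_mass_lborel:
  "scaled_mass a f y L = ennreal (L powr - a) * (\<integral>\<^sup>+z\<in>cube y L. ennreal (norm (f z)) \<partial>lborel)"
  by (simp add: scaled_mass_def nn_integral_completion)

lemma nn_integral_kernel_diff_mass:
  assumes a: "0 < a" "a < real CARD('n)"
  obtains C where "0 \<le> C" and "\<And>(f :: real^'n \<Rightarrow> complex) y l. f \<in> borel_measurable borel \<Longrightarrow> 0 < l \<Longrightarrow>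
    (\<integral>\<^sup>+x\<in>cube y l. (\<integral>\<^sup>+x'\<in>cube y l. (\<integral>\<^sup>+z.
        ennreal \<bar>norm (x - z) powr - a - norm (x' - z) powr - a\<bar>
            * ennreal (norm (f z)) \<partial>lborel) \<partial>lborel) \<partial>lborel)
      \<le> ennreal (C * (l ^ CARD('n))\<^sup>2) * (\<Sum>i. ennreal ((1 / 3) ^ Suc i) * scaled_mass a f y (3 ^ Suc i * l))"
proof -
  obtain C where C: "0 \<le> C" "\<And>y z :: real^'n. \<And>l. 0 < l \<Longrightarrow>
    (\<integral>\<^sup>+x\<in>cube y l. (\<integral>\<^sup>+x'\<in>cube y l.
        ennreal \<bar>norm (x - z) powr - a - norm (x' - z) powr - a\<bar> \<partial>lborel) \<partial>lborel)
      \<le> ennreal (C * (l ^ CARD('n))\<^sup>2) *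
         (\<Sum>i. ennreal ((1 / 3) ^ Suc i * (3 ^ Suc i * l) powr - a) * indicator (cube y (3 ^ Suc i * l)) z)"
    using nn_integral_kernel_diff[OF a] by blast
  have "(\<integral>\<^sup>+x\<in>cube y l. (\<integral>\<^sup>+x'\<in>cube y l. (\<integral>\<^sup>+z.
        ennreal \<bar>norm (x - z) powr - a - norm (x' - z) powr - a\<bar>
            * ennreal (norm (f z)) \<partial>lborel) \<partial>lborel) \<partial>lborel)
      \<le> ennreal (C * (l ^ CARD('n))\<^sup>2) * (\<Sum>i. ennreal ((1 / 3) ^ Suc i) * scaled_mass a f y (3 ^ Suc i * l))"
    (is "?I \<le> ennreal ?D * _")
    if f[measurable]: "f \<in> borel_measurable borel" and l: "0 < l" for f :: "real^'n \<Rightarrow> complex" and y l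
  proof -
    let ?Q = "indicator (cube y l) :: real^'n \<Rightarrow> ennreal"
    let ?h = "\<lambda>z. ennreal (norm (f z))"
    let ?K = "\<lambda>x x' z :: real^'n. ennreal \<bar>norm (x - z) powr - a - norm (x' - z) powr - a\<bar>"
    have "?I = (\<integral>\<^sup>+x. (\<integral>\<^sup>+x'. (\<integral>\<^sup>+z. ?K x x' z * ?Q x' * ?Q x * ?h z \<partial>lborel) \<partial>lborel) \<partial>lborel)"
      by (intro nn_integral_cong, subst nn_integral_multc[symmetric], measurable,
          intro nn_integral_cong, subst nn_integral_multc[symmetric], measurable,
          subst nn_integral_multc[symmetric], measurable) (simp add: mult_ac)
    also have "\<dots> = (\<integral>\<^sup>+x. (\<integral>\<^sup>+z. (\<integral>\<^sup>+x'. ?K x x' z * ?Q x' * ?Q x * ?h z \<partial>lborel) \<partial>lborel) \<partial>lborel)"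
      by (intro nn_integral_cong lborel_pair.Fubini') (simp add: case_prod_beta)
    also have "\<dots> = (\<integral>\<^sup>+z. (\<integral>\<^sup>+x. (\<integral>\<^sup>+x'. ?K x x' z * ?Q x' * ?Q x * ?h z \<partial>lborel) \<partial>lborel) \<partial>lborel)"
      by (intro lborel_pair.Fubini') (simp add: case_prod_beta)
    also have "\<dots> = (\<integral>\<^sup>+z. (\<integral>\<^sup>+x\<in>cube y l. (\<integral>\<^sup>+x'\<in>cube y l. ?K x x' z \<partial>lborel) \<partial>lborel) * ?h z \<partial>lborel)"
      by (simp add: nn_integral_multc)
    also have "\<dots> \<le> (\<integral>\<^sup>+z. (ennreal ?D * (\<Sum>i. ennreal ((1 / 3) ^ Suc i * (3 ^ Suc i * l) powr - a)
        * indicator (cube y (3 ^ Suc i * l)) z)) * ?h z \<partial>lborel)"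
      using l by (intro nn_integral_mono mult_right_mono C) auto
    also have "\<dots> = (\<integral>\<^sup>+z. ennreal ?D * (\<Sum>i. ennreal ((1 / 3) ^ Suc i * (3 ^ Suc i * l) powr - a)
        * (?h z * indicator (cube y (3 ^ Suc i * l)) z)) \<partial>lborel)"
      by (simp add: ennreal_suminf_multc[symmetric] mult_ac)
    also have "\<dots> = ennreal ?D * (\<Sum>i. ennreal ((1 / 3) ^ Suc i * (3 ^ Suc i * l) powr - a)
        * (\<integral>\<^sup>+z\<in>cube y (3 ^ Suc i * l). ?h z \<partial>lborel))"
      by (simp add: nn_integral_cmult nn_integral_suminf)
    also have "\<dots> = ennreal ?D * (\<Sum>i. ennreal ((1 / 3) ^ Suc i) * scaled_mass a f y (3 ^ Suc i * l))"
      unfolding scaled_mass_lborel mult.assoc[symmetric]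
      by (subst ennreal_mult) (use l in auto)
    finally show ?thesis .
  qed
  with C(1) show ?thesis using that by blast
qed

lemma cube_avg_lborel:
  assumes "0 < l"
  shows "cube_avg g (y :: real^'n) l = ennreal (1 / l ^ CARD('n)) * (\<integral>\<^sup>+x\<in>cube y l. g x \<partial>lborel)"
  using assms
  by (simp add: cube_avg_def nn_integral_completion emeasure_cube divide_ennreal_def inverse_ennreal
      mult.commute divide_inverse)

lemma cube_mean_lborel:
  assumes "0 < l" and [measurable]: "f \<in> borel_measurable borel"
  shows "cube_mean f (y :: real^'n) l = (LINT x:cube y l|lborel. f x) /\<^sub>R l ^ CARD('n)"
  using assms unfolding cube_mean_def set_lebesgue_integral_def
  by (subst integral_completion) (simp_all add: emeasure_cube measure_def)

lemma cube_avg_oscillation_le: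
  fixes F :: "real^'n \<Rightarrow> complex"
  assumes l: "0 < l" and [measurable]: "F \<in> borel_measurable borel"
    and int: "set_integrable lborel (cube y l) F"
  shows "cube_avg (\<lambda>x. ennreal (norm (F x - cube_mean F y l))) y l
    \<le> ennreal (1 / (l ^ CARD('n))\<^sup>2) * (\<integral>\<^sup>+x\<in>cube y l. (\<integral>\<^sup>+x'\<in>cube y l. ennreal (norm (F x - F x'))
        \<partial>lborel) \<partial>lborel)"
proof -
  let ?v = "l ^ CARD('n)"
  have v: "0 < ?v" using l by simp
  have em: "emeasure lborel (cube y l) = ennreal ?v" using l by (rule emeasure_cube)
  then have me: "measure lborel (cube y l) = ?v" using v by (simp add: measure_def)
  have pt: "ennreal (norm (F x - cube_mean F y l))
      \<le> ennreal (1 / ?v) * (\<integral>\<^sup>+x'\<in>cube y l. ennreal (norm (F x - F x')) \<partial>lborel)" for x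
  proof -
    have intd: "integrable lborel (\<lambda>x'. indicator (cube y l) x' *\<^sub>R (F x - F x'))"
      using int em unfolding set_integrable_def scaleR_diff_right
      by (intro Bochner_Integration.integrable_diff integrable_scaleR_left integrable_real_indicator) auto
    have "F x - cube_mean F y l = (LINT x'|lborel. indicator (cube y l) x' *\<^sub>R (F x - F x')) /\<^sub>R ?v"
    proof -
      have "(LINT x'|lborel. indicator (cube y l) x' *\<^sub>R (F x - F x'))
          = (LINT x'|lborel. indicator (cube y l) x' *\<^sub>R F x) - (LINT x'|lborel. indicator (cube y
              l) x' *\<^sub>R F x')"
        using int em unfolding set_integrable_def scaleR_diff_right
        by (intro Bochner_Integration.integral_diff integrable_scaleR_left integrable_real_indicator) auto
      also have "(LINT x'|lborel. indicator (cube y l) x' *\<^sub>R F x) = ?v *\<^sub>R F x"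
        using me em by (subst integral_scaleR_left) auto
      finally show ?thesis
        using v l by (simp add: cube_mean_lborel set_lebesgue_integral_def scaleR_diff_right)
    qed
    then have "ennreal (norm (F x - cube_mean F y l))
        = ennreal (1 / ?v) * ennreal (norm (LINT x'|lborel. indicator (cube y l) x' *\<^sub>R (F x - F x')))"
      using v by (simp add: ennreal_mult[symmetric] divide_inverse)
    also have "\<dots> \<le> ennreal (1 / ?v) * (\<integral>\<^sup>+x'. ennreal (norm (indicator (cube y l) x' *\<^sub>R (F x - F
        x'))) \<partial>lborel)"
      by (intro mult_left_mono integral_norm_bound_ennreal intd) auto
    also have "(\<integral>\<^sup>+x'. ennreal (norm (indicator (cube y l) x' *\<^sub>R (F x - F x'))) \<partial>lborel)
        = (\<integral>\<^sup>+x'\<in>cube y l. ennreal (norm (F x - F x')) \<partial>lborel)"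
      by (intro nn_integral_cong) (simp add: indicator_def)
    finally show ?thesis .
  qed
  have "cube_avg (\<lambda>x. ennreal (norm (F x - cube_mean F y l))) y l
      \<le> ennreal (1 / ?v) * (\<integral>\<^sup>+x\<in>cube y l. (ennreal (1 / ?v)
          * (\<integral>\<^sup>+x'\<in>cube y l. ennreal (norm (F x - F x')) \<partial>lborel)) \<partial>lborel)"
    unfolding cube_avg_lborel[OF l] by (intro mult_left_mono nn_integral_mono mult_right_mono pt) auto
  also have "\<dots> = ennreal (1 / ?v) * ennreal (1 / ?v)
      * (\<integral>\<^sup>+x\<in>cube y l. (\<integral>\<^sup>+x'\<in>cube y l. ennreal (norm (F x - F x')) \<partial>lborel) \<partial>lborel)"
    by (simp add: nn_integral_cmult mult.assoc)
  also have "ennreal (1 / ?v) * ennreal (1 / ?v) = ennreal (1 / ?v\<^sup>2)"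
    using v by (subst ennreal_mult[symmetric]) (auto simp: power2_eq_square)
  finally show ?thesis .
qed

text \<open>The oscillation on a cube is controlled by the scaled masses of the concentric cubes of side
  \<open>3 ^ Suc i * l\<close>, with geometrically decaying coefficients.\<close>

lemma oscillation_frac_integral_borel:
  assumes \<gamma>: "0 < \<gamma>" "\<gamma> < real CARD('n)"
  obtains C where "0 \<le> C" and "\<And>(f :: real^'n \<Rightarrow> complex) y l. f \<in> borel_measurable borel \<Longrightarrow> 0 < l \<Longrightarrow>
    cube_avg (\<lambda>x. ennreal (norm (frac_integral \<gamma> f x - cube_mean (frac_integral \<gamma> f) y l))) y l
      \<le> ennreal C * (\<Sum>i. ennreal ((1 / 3) ^ Suc i) * scaled_mass (real CARD('n) - \<gamma>) f y (3 ^ Suc i * l))"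
proof -
  define a where "a = real CARD('n) - \<gamma>"
  have a: "0 < a" "a < real CARD('n)" using \<gamma> by (auto simp: a_def)
  define c where "c = 1 / riesz_const (real CARD('n)) \<gamma>"
  obtain C where C: "0 \<le> C" "\<And>(f :: real^'n \<Rightarrow> complex) y l. f \<in> borel_measurable borel \<Longrightarrow> 0 < l \<Longrightarrow>
    (\<integral>\<^sup>+x\<in>cube y l. (\<integral>\<^sup>+x'\<in>cube y l. (\<integral>\<^sup>+z.
        ennreal \<bar>norm (x - z) powr - a - norm (x' - z) powr - a\<bar>
            * ennreal (norm (f z)) \<partial>lborel) \<partial>lborel) \<partial>lborel)
      \<le> ennreal (C * (l ^ CARD('n))\<^sup>2) * (\<Sum>i. ennreal ((1 / 3) ^ Suc i) * scaled_mass a f y (3 ^ Suc i * l))"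
    using nn_integral_kernel_diff_mass[OF a] by blast
  have "cube_avg (\<lambda>x. ennreal (norm (frac_integral \<gamma> f x - cube_mean (frac_integral \<gamma> f) y l))) y l
      \<le> ennreal (\<bar>c\<bar> * C) * (\<Sum>i. ennreal ((1 / 3) ^ Suc i) * scaled_mass a f y (3 ^ Suc i * l))"
    if f[measurable]: "f \<in> borel_measurable borel" and l: "0 < l" for f :: "real^'n \<Rightarrow> complex" and y l
  proof (cases "finite_tail a f")
    case True
    \<comment> \<open>The potential is finite almost everywhere, so differences of its values are integrals of differences.\<close>
    let ?F = "frac_integral \<gamma> f"
    let ?v = "l ^ CARD('n)"
    let ?S = "\<Sum>i. ennreal ((1 / 3) ^ Suc i) * scaled_mass a f y (3 ^ Suc i * l)"
    let ?D = "\<lambda>x x'. \<integral>\<^sup>+z. ennreal \<bar>norm (x - z) powr - a - norm (x' - z) powr - a\<bar>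
        * ennreal (norm (f z)) \<partial>lborel"
    have ae: "AE x in lborel. integrable lborel (riesz_integrand \<gamma> f x)"
      using AE_integrable_riesz_integrand[OF f \<gamma>] True by (simp add: a_def)
    have diff: "ennreal (norm (?F x - ?F x')) \<le> ennreal \<bar>c\<bar> * ?D x x'"
      if x: "integrable lborel (riesz_integrand \<gamma> f x)" "integrable lborel (riesz_integrand \<gamma> f x')" for x x'
    proof -
      have "?F x - ?F x' = c *\<^sub>R (LINT z|lborel. riesz_integrand \<gamma> f x z - riesz_integrand \<gamma> f x' z)"
        using x by (simp add: frac_integral_lborel c_def scaleR_diff_right)
      then have "ennreal (norm (?F x - ?F x')) = ennreal \<bar>c\<bar>
          * ennreal (norm (LINT z|lborel. riesz_integrand \<gamma> f x z - riesz_integrand \<gamma> f x' z))"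
        by (simp add: ennreal_mult)
      also have "\<dots> \<le> ennreal \<bar>c\<bar> * (\<integral>\<^sup>+z. ennreal (norm (riesz_integrand \<gamma> f x z - riesz_integrand \<gamma>
          f x' z)) \<partial>lborel)"
        using x by (intro mult_left_mono integral_norm_bound_ennreal) auto
      also have "(\<integral>\<^sup>+z. ennreal (norm (riesz_integrand \<gamma> f x z - riesz_integrand \<gamma> f x' z)) \<partial>lborel) = ?D x x'"
        unfolding riesz_integrand_eq a_def[symmetric] scaleR_diff_left[symmetric]
        by (simp add: ennreal_mult)
      finally show ?thesis .
    qed
    have "set_integrable lebesgue (cube y l) ?F"
      using locally_integrable_frac_integral_borel[OF f \<gamma>] compact_cube by (auto simp: locally_integrable_def)
    then have "set_integrable lborel (cube y l) ?F"
      unfolding set_integrable_def by (subst (asm) integrable_completion) auto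
    then have "cube_avg (\<lambda>x. ennreal (norm (?F x - cube_mean ?F y l))) y l
        \<le> ennreal (1 / ?v\<^sup>2) * (\<integral>\<^sup>+x\<in>cube y l. (\<integral>\<^sup>+x'\<in>cube y l. ennreal (norm (?F x - ?F x')) \<partial>lborel) \<partial>lborel)"
      using l by (intro cube_avg_oscillation_le) auto
    also have "\<dots> \<le> ennreal (1 / ?v\<^sup>2) * (\<integral>\<^sup>+x\<in>cube y l. (\<integral>\<^sup>+x'\<in>cube y l. ennreal \<bar>c\<bar>
        * ?D x x' \<partial>lborel) \<partial>lborel)"
    proof (intro mult_left_mono nn_integral_mono_AE)
      show "AE x in lborel. (\<integral>\<^sup>+x'\<in>cube y l. ennreal (norm (?F x - ?F x')) \<partial>lborel) * indicator (cube y l) x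
          \<le> (\<integral>\<^sup>+x'\<in>cube y l. ennreal \<bar>c\<bar> * ?D x x' \<partial>lborel) * indicator (cube y l) x"
        using ae
      proof eventually_elim
        case (elim x)
        show ?case
          using ae by (intro mult_right_mono nn_integral_mono_AE)
              (auto elim!: eventually_mono intro!: mult_right_mono diff elim)
      qed
    qed auto
    also have "\<dots> = ennreal (1 / ?v\<^sup>2) * (ennreal \<bar>c\<bar>
        * (\<integral>\<^sup>+x\<in>cube y l. (\<integral>\<^sup>+x'\<in>cube y l. ?D x x' \<partial>lborel) \<partial>lborel))"
      by (simp add: nn_integral_cmult mult.assoc)
    also have "\<dots> \<le> ennreal (1 / ?v\<^sup>2) * (ennreal \<bar>c\<bar> * (ennreal (C * ?v\<^sup>2) * ?S))"
      by (intro mult_left_mono C f l) auto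
    also have "\<dots> = ennreal (1 / ?v\<^sup>2 * (\<bar>c\<bar> * (C * ?v\<^sup>2))) * ?S"
      using C(1) l by (simp only: mult.assoc[symmetric] ennreal_mult[symmetric] abs_ge_zero zero_le_power2
          zero_le_divide_1_iff mult_nonneg_nonneg)
    also have "1 / ?v\<^sup>2 * (\<bar>c\<bar> * (C * ?v\<^sup>2)) = \<bar>c\<bar> * C" using l by simp
    finally show ?thesis .
  next
    case False
    \<comment> \<open>The defining integral diverges everywhere, the potential is 0 by convention and does not oscillate.\<close>
    then have "\<not> integrable lborel (riesz_integrand \<gamma> f x)" for x
      using finite_tail_if_integrable[OF f \<gamma>(2)] by (auto simp: a_def)
    then have "frac_integral \<gamma> f x = 0" for x
      by (simp add: frac_integral_lborel not_integrable_integral_eq)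
    then have "frac_integral \<gamma> f = (\<lambda>x. 0)" by auto
    then show ?thesis by (simp add: cube_avg_def cube_mean_def set_lebesgue_integral_def)
  qed
  moreover have "0 \<le> \<bar>c\<bar> * C" using C(1) by simp
  ultimately show ?thesis using that unfolding a_def by blast
qed

section \<open>The two-weight condition\<close>

lemma epowr_neg_epowr: "0 < a \<Longrightarrow> 0 < b \<Longrightarrow> epowr (epowr x (- a)) b = epowr x (- (a * b))"
  by (cases x rule: ennreal_cases) (auto simp: epowr_def powr_powr less_top[symmetric])

lemma locally_integrable_measurable:
  fixes f :: "real^'n \<Rightarrow> 'b :: euclidean_space"
  assumes f: "locally_integrable f" shows "f \<in> borel_measurable lebesgue"
proof (rule borel_measurable_LIMSEQ_metric)
  show "(\<lambda>x. indicator (cube 0 (real k)) x *\<^sub>R f x) \<in> borel_measurable lebesgue" for k :: nat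
    using f compact_cube[of 0 "real k"]
    unfolding locally_integrable_def set_integrable_def by (blast dest: borel_measurable_integrable)
next
  fix x :: "real^'n"
  obtain l where l: "0 < l" "{x} \<subseteq> cube 0 l" using compact_subset_cube[of "{x}"] by auto
  have "eventually (\<lambda>k. indicator (cube 0 (real k)) x *\<^sub>R f x = f x) sequentially"
    using eventually_ge_at_top[of "nat \<lceil>l\<rceil>"]
  proof eventually_elim
    case (elim k)
    then have "l \<le> real k" by linarith
    then show ?case using l cube_mono by (auto simp: indicator_def)
  qed
  then show "(\<lambda>k. indicator (cube 0 (real k)) x *\<^sub>R f x) \<longlonglongrightarrow> f x"
    by (rule tendsto_eventually)
qed

lemma weight_of_cube_finite:
  assumes "weight w" shows "weight_of w (cube y l) < \<infinity>"
proof -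
  have "integrable lebesgue (\<lambda>x. indicator (cube y l) x *\<^sub>R w x)"
    using assms compact_cube[of y l] by (auto simp: weight_def locally_integrable_def set_integrable_def)
  then have "(\<integral>\<^sup>+x. ennreal (norm (indicator (cube y l) x *\<^sub>R w x)) \<partial>lebesgue) < \<infinity>"
    by (simp add: integrable_iff_bounded)
  also have "(\<integral>\<^sup>+x. ennreal (norm (indicator (cube y l) x *\<^sub>R w x)) \<partial>lebesgue) = weight_of w (cube y l)"
    unfolding weight_of_def using assms
    by (intro nn_integral_cong) (auto simp: indicator_def weight_def)
  finally show ?thesis .
qed

lemma cube_avg_eq:
  assumes "0 < l"
  shows "cube_avg g (y :: real^'n) l = ennreal (1 / l ^ CARD('n)) * (\<integral>\<^sup>+x\<in>cube y l. g x \<partial>lebesgue)"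
  using cube_avg_lborel[OF assms] by (simp add: nn_integral_completion)

lemma cube_avg_Jensen:
  assumes l: "0 < l" and [measurable]: "g \<in> borel_measurable lebesgue" and r: "1 < r"
  shows "epowr (cube_avg g (y :: real^'n) l) r \<le> cube_avg (\<lambda>x. epowr (g x) r) y l"
proof -
  let ?M = "density lebesgue (\<lambda>x. ennreal (1 / l ^ CARD('n)) * indicator (cube y l) x)"
  have int: "(\<integral>\<^sup>+x. h x \<partial>?M) = cube_avg h y l" if [measurable]: "h \<in> borel_measurable lebesgue" for h
    unfolding cube_avg_eq[OF l]
    by (subst nn_integral_density, measurable, subst nn_integral_cmult[symmetric], measurable) (simp
        add: mult_ac)
  have "emeasure ?M (space ?M) = (\<integral>\<^sup>+x. 1 \<partial>?M)" by simp
  also have "\<dots> = cube_avg (\<lambda>x. 1) y l" by (rule int) measurable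
  also have "\<dots> = 1"
    using l by (simp add: cube_avg_eq emeasure_cube ennreal_mult[symmetric])
  finally have "emeasure ?M (space ?M) \<le> 1" by simp
  from nn_integral_Jensen_epowr[OF _ this r, of g] show ?thesis by (simp add: int)
qed

text \<open>Hoelder's inequality with the factors \<open>\<bar>f\<bar> * \<nu> powr (1 / p)\<close> and \<open>\<nu> powr - (1 / p)\<close>.
  Finiteness of the second integral makes \<open>\<nu>\<close> positive almost everywhere on the cube, so that the
  product of the factors is \<open>\<bar>f\<bar>\<close>.\<close>

lemma nn_integral_cube_Holder:
  fixes f :: "real^'n \<Rightarrow> complex" and \<nu> :: "real^'n \<Rightarrow> real"
  assumes [measurable]: "f \<in> borel_measurable lebesgue" and \<nu>: "weight \<nu>" and p: "1 < p"
    and fin: "(\<integral>\<^sup>+x\<in>cube y l. epowr (ennreal (\<nu> x)) (- (conj_exp p / p)) \<partial>lebesgue) < \<infinity>" (is "?V < \<infinity>")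
  shows "(\<integral>\<^sup>+x\<in>cube y l. ennreal (norm (f x)) \<partial>lebesgue)
    \<le> Lnorm (ereal p) \<nu> (\<lambda>x. ennreal (norm (f x)) * indicator (cube y l) x) * epowr ?V (1 / conj_exp p)"
proof -
  have [measurable]: "\<nu> \<in> borel_measurable lebesgue" using \<nu> by (simp add: weight_def
      locally_integrable_measurable)
  define p' where "p' = conj_exp p"
  have p': "1 < p'" "1 / p + 1 / p' = 1" using p by (auto simp: p'_def conj_exp_def field_simps)
  let ?Q = "indicator (cube y l) :: real^'n \<Rightarrow> ennreal"
  let ?g = "\<lambda>x. ennreal (norm (f x)) * ?Q x"
  let ?n = "\<lambda>x. ennreal (\<nu> x)"
  have "AE x in lebesgue. epowr (?n x) (- (p' / p)) * ?Q x \<noteq> \<infinity>"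
    using fin by (intro nn_integral_PInf_AE) (auto simp: p'_def)
  then have "AE x in lebesgue. ?g x = (?g x * epowr (?n x) (1 / p)) * (epowr (?n x) (- (1 / p)) * ?Q x)"
  proof eventually_elim
    case (elim x)
    show ?case
    proof (cases "x \<in> cube y l")
      case True
      have "\<nu> x \<noteq> 0" using elim True p p' by (auto simp: epowr_def)
      then have "0 < \<nu> x" using \<nu> by (simp add: weight_def less_le)
      then have "epowr (?n x) (1 / p) * epowr (?n x) (- (1 / p)) = 1"
        by (simp add: epowr_ennreal_pos ennreal_mult[symmetric] powr_minus)
      then show ?thesis using True by (simp add: mult.assoc)
    qed simp
  qed
  then have "(\<integral>\<^sup>+x. ?g x \<partial>lebesgue) = (\<integral>\<^sup>+x. (?g x * epowr (?n x) (1 / p))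
      * (epowr (?n x) (- (1 / p)) * ?Q x) \<partial>lebesgue)"
    by (rule nn_integral_cong_AE)
  also have "\<dots> \<le> epowr (\<integral>\<^sup>+x. epowr (?g x * epowr (?n x) (1 / p)) p \<partial>lebesgue) (1 / p)
      * epowr (\<integral>\<^sup>+x. epowr (epowr (?n x) (- (1 / p)) * ?Q x) p' \<partial>lebesgue) (1 / p')"
    using p p' by (intro nn_integral_Holder) auto
  also have "(\<integral>\<^sup>+x. epowr (?g x * epowr (?n x) (1 / p)) p \<partial>lebesgue) = (\<integral>\<^sup>+x. epowr (?g x) p * ?n x \<partial>lebesgue)"
    using p by (simp add: epowr_mult epowr_cancel')
  also have "(\<integral>\<^sup>+x. epowr (epowr (?n x) (- (1 / p)) * ?Q x) p' \<partial>lebesgue) = ?V"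
    using p p' by (intro nn_integral_cong) (simp add: epowr_mult epowr_neg_epowr p'_def[symmetric]
        indicator_def)
  finally show ?thesis by (simp add: Lnorm_def p'_def)
qed

text \<open>The only use of the weight condition. By Jensen's inequality the average of \<open>w\<close> is at most
  that of \<open>w powr r\<close> to the power \<open>1 / r\<close>, and the condition becomes a bound for
  \<open>l powr (\<gamma> - n) * (\<integral>\<nu> powr - (p' / p)) powr (1 / p')\<close> by \<open>w(Q) powr - (1 / q)\<close>, which is the
  factor missing after Hoelder's inequality.\<close>

lemma scaled_mass_le_amalgam_integrand:
  assumes \<gamma>: "0 < \<gamma>" "\<gamma> < real CARD('n)" and p: "1 < p" "p < q" and r: "1 < r"
    and w: "weight w" and \<nu>: "weight \<nu>" and bump: "two_weight_bump \<gamma> p q r w \<nu>"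
  obtains C where "0 < C" and "\<And>(f :: real^'n \<Rightarrow> complex) y l. f \<in> borel_measurable lebesgue \<Longrightarrow> 0 < l \<Longrightarrow>
    scaled_mass (real CARD('n) - \<gamma>) f y l \<le> ennreal C *
      (epowr (weight_of w (cube y l)) (- (1 / q)) * Lnorm (ereal p) \<nu> (\<lambda>x. ennreal (norm (f x))
          * indicator (cube y l) x))"
proof -
  let ?n = "real CARD('n)"
  define a where "a = ?n - \<gamma>"
  define p' where "p' = conj_exp p"
  have p': "1 < p'" "1 / p + 1 / p' = 1" using p by (auto simp: p'_def conj_exp_def field_simps)
  obtain C where C: "\<And>(y :: real^'n) l. 0 < l \<Longrightarrow>
        cube_avg (\<lambda>x. epowr (ennreal (\<nu> x)) (- (p' / p))) y l < \<infinity> \<and>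
        epowr (emeasure lebesgue (cube y l)) (\<gamma> / ?n + 1/q - 1/p)
        * epowr (cube_avg (\<lambda>x. epowr (ennreal (w x)) r) y l) (1 / (r * q))
        * epowr (cube_avg (\<lambda>x. epowr (ennreal (\<nu> x)) (- (p' / p))) y l) (1 / p')
        \<le> ennreal C"
    using bump unfolding two_weight_bump_def p'_def by blast
  have [measurable]: "w \<in> borel_measurable lebesgue" using w by (simp add: weight_def
      locally_integrable_measurable)
  have "scaled_mass a f y l \<le> ennreal (max C 1) *
      (epowr (weight_of w (cube y l)) (- (1 / q)) * Lnorm (ereal p) \<nu> (\<lambda>x. ennreal (norm (f x))
          * indicator (cube y l) x))"
    (is "_ \<le> ennreal ?C * (epowr ?W _ * ?F)")
    if f: "f \<in> borel_measurable lebesgue" and l: "0 < l" for f :: "real^'n \<Rightarrow> complex" and y l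
  proof -
    define v where "v = l ^ CARD('n)"
    have v: "0 < v" using l by (simp add: v_def)
    define V where "V = (\<integral>\<^sup>+x\<in>cube y l. epowr (ennreal (\<nu> x)) (- (p' / p)) \<partial>lebesgue)"
    have avgV: "cube_avg (\<lambda>x. epowr (ennreal (\<nu> x)) (- (p' / p))) y l = ennreal (1 / v) * V"
      using l by (simp add: cube_avg_eq V_def v_def)
    have V: "V < \<infinity>"
      using C[OF l, of y] v unfolding avgV by (auto simp: ennreal_mult_less_top)
    have H: "(\<integral>\<^sup>+x\<in>cube y l. ennreal (norm (f x)) \<partial>lebesgue) \<le> ?F * epowr V (1 / p')"
      using nn_integral_cube_Holder[OF f \<nu> p(1), of y l] V by (simp add: V_def p'_def)
    show ?thesis
    proof (cases "?W = 0")
      case True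
      \<comment> \<open>Here \<open>epowr ?W (- (1 / q))\<close> is infinite, and so is the right-hand side unless \<open>f\<close>
        vanishes almost everywhere on the cube.\<close>
      show ?thesis
      proof (cases "?F = 0")
        case True
        then show ?thesis using H by (simp add: scaled_mass_def)
      next
        case False
        with True have "epowr ?W (- (1 / q)) * ?F = top"
          using p by (simp add: epowr_def ennreal_top_mult)
        then show ?thesis by (simp add: ennreal_mult_top)
      qed
    next
      case False
      then obtain W where W: "?W = ennreal W" "0 < W"
        using weight_of_cube_finite[OF w, of y l] by (cases ?W rule: ennreal_cases) (auto simp: less_le)
      obtain V' where V': "V = ennreal V'" "0 \<le> V'"
        using V by (cases V rule: ennreal_cases) auto
      have avgw: "cube_avg (\<lambda>x. ennreal (w x)) y l = ennreal (W / v)"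
        using W l v by (simp add: cube_avg_eq weight_of_def v_def ennreal_mult[symmetric])
      have "epowr (ennreal (W / v)) (1 / q) = epowr (epowr (ennreal (W / v)) r) (1 / (r * q))"
        using r p by (simp add: epowr_epowr)
      also have "\<dots> \<le> epowr (cube_avg (\<lambda>x. epowr (ennreal (w x)) r) y l) (1 / (r * q))"
        unfolding avgw[symmetric] using r p by (intro epowr_mono cube_avg_Jensen l) auto
      finally have J: "ennreal ((W / v) powr (1 / q))
          \<le> epowr (cube_avg (\<lambda>x. epowr (ennreal (w x)) r) y l) (1 / (r * q))"
        using W v by (simp add: epowr_ennreal_pos)
      have "ennreal (v powr (\<gamma> / ?n + 1/q - 1/p)) * ennreal ((W / v) powr (1 / q))
          * ennreal ((V' / v) powr (1 / p'))
          \<le> epowr (emeasure lebesgue (cube y l)) (\<gamma> / ?n + 1/q - 1/p)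
          * epowr (cube_avg (\<lambda>x. epowr (ennreal (w x)) r) y l) (1 / (r * q))
          * epowr (cube_avg (\<lambda>x. epowr (ennreal (\<nu> x)) (- (p' / p))) y l) (1 / p')"
        using v p' l V' J unfolding avgV
        by (intro mult_mono)
           (auto simp: emeasure_cube v_def[symmetric] epowr_ennreal_pos epowr_ennreal ennreal_mult[symmetric])
      also have "\<dots> \<le> ennreal C" using C[OF l] by blast
      also have "\<dots> \<le> ennreal ?C" by (intro ennreal_leI) auto
      finally have "v powr (\<gamma> / ?n + 1/q - 1/p) * (W / v) powr (1 / q) * (V' / v) powr (1 / p') \<le> ?C"
        by (simp add: ennreal_mult[symmetric] ennreal_le_iff)
      moreover have "v powr (\<gamma> / ?n + 1/q - 1/p) * (W / v) powr (1 / q) * (V' / v) powr (1 / p')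
          = l powr - a * V' powr (1 / p') * W powr (1 / q)"
      proof -
        have "v powr (\<gamma> / ?n + 1/q - 1/p) * v powr - (1 / q) * v powr - (1 / p') = v powr (\<gamma> / ?n - 1)"
        proof -
          have e: "\<gamma> / ?n + 1/q - 1/p + - (1 / q) + - (1 / p') = \<gamma> / ?n - 1" using p'(2) by linarith
          show ?thesis by (simp only: powr_add[symmetric] e)
        qed
        also have "v powr (\<gamma> / ?n - 1) = l powr - a"
        proof -
          have "v = l powr ?n" using l by (simp add: v_def powr_realpow)
          moreover have "?n * (\<gamma> / ?n - 1) = - a" by (simp add: a_def right_diff_distrib)
          ultimately show ?thesis by (simp add: powr_powr)
        qed
        finally have e1: "v powr (\<gamma> / ?n + 1/q - 1/p) * v powr - (1 / q) * v powr - (1 / p') = l powr - a" .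
        have e2: "(W / v) powr (1 / q) = W powr (1 / q) * v powr - (1 / q)"
            "(V' / v) powr (1 / p') = V' powr (1 / p') * v powr - (1 / p')"
          using W V' v by (simp_all add: powr_divide powr_minus divide_simps)
        show ?thesis unfolding e1[symmetric] e2 by (simp only: mult_ac)
      qed
      ultimately have "l powr - a * V' powr (1 / p') * W powr (1 / q) * W powr - (1 / q) \<le> ?C
          * W powr - (1 / q)"
        by (intro mult_right_mono) auto
      then have main: "l powr - a * V' powr (1 / p') \<le> ?C * W powr - (1 / q)"
        using W by (simp add: mult.assoc powr_minus)
      have "scaled_mass a f y l \<le> ennreal (l powr - a) * (?F * epowr V (1 / p'))"
        unfolding scaled_mass_def by (intro mult_left_mono H) auto
      also have "\<dots> = ennreal (l powr - a * V' powr (1 / p')) * ?F"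
        using V' p' by (simp add: epowr_ennreal ennreal_mult mult_ac)
      also have "\<dots> \<le> ennreal (?C * W powr - (1 / q)) * ?F"
        by (intro mult_right_mono ennreal_leI main) auto
      also have "\<dots> = ennreal ?C * (epowr ?W (- (1 / q)) * ?F)"
        using W by (simp add: epowr_ennreal_pos ennreal_mult mult_ac)
      finally show ?thesis .
    qed
  qed
  moreover have "0 < max C 1" by simp
  ultimately show ?thesis using that unfolding a_def by blast
qed

section \<open>Series of functions in weighted Lebesgue spaces\<close>

text \<open>A weighted average of functions obeys the common bound of their norms. For finite \<open>s\<close> this
  is convexity of the power \<open>s\<close> under the integral. The functions \<open>G i\<close> need not be measurable:
  for finite \<open>s\<close> their norm is defined by a lower integral, which is monotone, and the essential
  supremum of a function that is not measurable is infinite.\<close>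

lemma Lnorm_suminf_le:
  fixes \<theta> :: "nat \<Rightarrow> ennreal" and \<Phi> :: "nat \<Rightarrow> real^'n \<Rightarrow> ennreal"
  assumes \<theta>: "(\<Sum>i. \<theta> i) \<le> 1" and [measurable]: "u \<in> borel_measurable lebesgue" "\<And>i. \<Phi> i
      \<in> borel_measurable lebesgue"
    and \<mu>: "weight \<mu>" and s: "1 < s" and K: "0 < K" and C: "0 < C"
    and u: "\<And>y. u y \<le> ennreal K * (\<Sum>i. \<theta> i * \<Phi> i y)"
    and \<Phi>: "\<And>i y. \<Phi> i y \<le> ennreal C * G i y" and N: "\<And>i. Lnorm s \<mu> (G i) \<le> N"
  shows "Lnorm s \<mu> u \<le> ennreal (K * C) * N"
proof (cases s)
  case PInf
  have [measurable]: "\<mu> \<in> borel_measurable lebesgue" using \<mu> by (simp add: weight_def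
      locally_integrable_measurable)
  let ?M = "density lebesgue (\<lambda>y. ennreal (\<mu> y))"
  have "AE y in ?M. G i y \<le> N" for i
  proof -
    have "AE y in ?M. G i y \<le> esssup ?M (G i)" by (rule esssup_AE)
    moreover have "esssup ?M (G i) \<le> N" using N[of i] PInf by (simp add: Lnorm_def)
    ultimately show ?thesis by (auto elim!: eventually_mono)
  qed
  then have "AE y in ?M. \<forall>i. G i y \<le> N" by (simp add: AE_all_countable)
  then have "AE y in ?M. u y \<le> ennreal (K * C) * N"
  proof eventually_elim
    case (elim y)
    have "u y \<le> ennreal K * (\<Sum>i. \<theta> i * \<Phi> i y)" by (rule u)
    also have "\<dots> \<le> ennreal K * (\<Sum>i. \<theta> i * (ennreal C * N))"
    proof (intro mult_left_mono suminf_le)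
      show "\<Phi> i y \<le> ennreal C * N" for i
        using \<Phi>[of i y] elim by (meson mult_left_mono order_trans zero_le)
    qed auto
    also have "\<dots> = (\<Sum>i. \<theta> i) * (ennreal K * (ennreal C * N))"
      by (simp add: ennreal_suminf_multc mult_ac)
    also have "\<dots> \<le> 1 * (ennreal K * (ennreal C * N))"
      by (intro mult_right_mono \<theta>) auto
    also have "\<dots> = ennreal (K * C) * N" using K C by (simp add: ennreal_mult mult_ac)
    finally show ?case .
  qed
  then show ?thesis using PInf by (auto simp: Lnorm_def intro!: esssup_I)
next
  case MInf
  then show ?thesis using s by simp
next
  case (real \<sigma>)
  have [measurable]: "\<mu> \<in> borel_measurable lebesgue" using \<mu> by (simp add: weight_def
      locally_integrable_measurable)
  have \<sigma>: "1 < \<sigma>" using s real by simp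
  have L: "Lnorm s \<mu> g = epowr (\<integral>\<^sup>+y. epowr (g y) \<sigma> * ennreal (\<mu> y) \<partial>lebesgue) (1 / \<sigma>)" for g
    using real by (simp add: Lnorm_def)
  let ?N = "epowr N \<sigma>"
  have NG: "(\<integral>\<^sup>+y. epowr (G i y) \<sigma> * ennreal (\<mu> y) \<partial>lebesgue) \<le> ?N" for i
  proof -
    have "epowr (Lnorm s \<mu> (G i)) \<sigma> \<le> ?N" using N \<sigma> by (intro epowr_mono) auto
    then show ?thesis using \<sigma> by (simp add: L epowr_cancel')
  qed
  have N\<Phi>: "(\<integral>\<^sup>+y. epowr (\<Phi> i y) \<sigma> * ennreal (\<mu> y) \<partial>lebesgue) \<le> epowr (ennreal C) \<sigma> * ?N" for i
  proof -
    have inv: "ennreal C * ennreal (1 / C) = 1" "ennreal (1 / C) * ennreal C = 1"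
      using C by (auto simp: ennreal_mult[symmetric])
    have "(\<integral>\<^sup>+y. epowr (\<Phi> i y) \<sigma> * ennreal (\<mu> y) \<partial>lebesgue)
        = (\<integral>\<^sup>+y. epowr (ennreal C) \<sigma> * (epowr (ennreal (1 / C) * \<Phi> i y) \<sigma> * ennreal (\<mu> y)) \<partial>lebesgue)"
      using \<sigma> inv by (simp add: mult.assoc[symmetric] epowr_mult[symmetric])
    also have "\<dots> = epowr (ennreal C) \<sigma> * (\<integral>\<^sup>+y. epowr (ennreal (1 / C) * \<Phi> i y) \<sigma> * ennreal (\<mu> y) \<partial>lebesgue)"
      by (intro nn_integral_cmult) measurable
    also have "\<dots> \<le> epowr (ennreal C) \<sigma> * (\<integral>\<^sup>+y. epowr (G i y) \<sigma> * ennreal (\<mu> y) \<partial>lebesgue)"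
    proof (intro mult_left_mono nn_integral_mono mult_right_mono epowr_mono)
      fix y
      have "ennreal (1 / C) * \<Phi> i y \<le> ennreal (1 / C) * (ennreal C * G i y)"
        by (intro mult_left_mono \<Phi>) auto
      then show "ennreal (1 / C) * \<Phi> i y \<le> G i y" by (simp add: mult.assoc[symmetric] inv)
    qed (use \<sigma> in auto)
    also have "\<dots> \<le> epowr (ennreal C) \<sigma> * ?N" by (intro mult_left_mono NG) auto
    finally show ?thesis .
  qed
  have "(\<integral>\<^sup>+y. epowr (u y) \<sigma> * ennreal (\<mu> y) \<partial>lebesgue)
      \<le> (\<integral>\<^sup>+y. epowr (ennreal K) \<sigma> * ((\<Sum>i. \<theta> i * (epowr (\<Phi> i y) \<sigma> * ennreal (\<mu> y)))) \<partial>lebesgue)"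
  proof (rule nn_integral_mono)
    fix y
    have "epowr (u y) \<sigma> \<le> epowr (ennreal K) \<sigma> * epowr (\<Sum>i. \<theta> i * \<Phi> i y) \<sigma>"
      using u[of y] \<sigma> by (subst epowr_mult[symmetric]) (auto intro: epowr_mono)
    also have "\<dots> \<le> epowr (ennreal K) \<sigma> * (\<Sum>i. \<theta> i * epowr (\<Phi> i y) \<sigma>)"
      by (intro mult_left_mono suminf_Jensen_epowr \<theta> \<sigma>) auto
    finally have "epowr (u y) \<sigma> * ennreal (\<mu> y) \<le> (epowr (ennreal K) \<sigma> * (\<Sum>i. \<theta> i
        * epowr (\<Phi> i y) \<sigma>)) * ennreal (\<mu> y)"
      by (rule mult_right_mono) simp
    then show "epowr (u y) \<sigma> * ennreal (\<mu> y) \<le> epowr (ennreal K) \<sigma> * ((\<Sum>i. \<theta> i * (epowr (\<Phi> i y) \<sigma>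
        * ennreal (\<mu> y))))"
      by (simp only: mult.assoc ennreal_suminf_multc[symmetric])
  qed
  also have "\<dots> = epowr (ennreal K) \<sigma> * (\<Sum>i. \<theta> i * (\<integral>\<^sup>+y. epowr (\<Phi> i y) \<sigma> * ennreal (\<mu> y) \<partial>lebesgue))"
    by (simp add: nn_integral_cmult nn_integral_suminf)
  also have "\<dots> \<le> epowr (ennreal K) \<sigma> * (\<Sum>i. \<theta> i * (epowr (ennreal C) \<sigma> * ?N))"
    by (intro mult_left_mono suminf_le N\<Phi>) auto
  also have "\<dots> = (\<Sum>i. \<theta> i) * epowr (ennreal K * (ennreal C * N)) \<sigma>"
    using \<sigma> by (simp add: ennreal_suminf_multc epowr_mult mult_ac)
  also have "\<dots> \<le> 1 * epowr (ennreal K * (ennreal C * N)) \<sigma>"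
    by (intro mult_right_mono \<theta>) auto
  finally have "(\<integral>\<^sup>+y. epowr (u y) \<sigma> * ennreal (\<mu> y) \<partial>lebesgue) \<le> epowr (ennreal (K * C) * N) \<sigma>"
    using K C by (simp add: ennreal_mult mult.assoc)
  then have "Lnorm s \<mu> u \<le> epowr (epowr (ennreal (K * C) * N) \<sigma>) (1 / \<sigma>)"
    unfolding L using \<sigma> by (intro epowr_mono) auto
  then show ?thesis using \<sigma> by (simp add: epowr_cancel)
qed

section \<open>The norm inequality\<close>

lemma ex_borel_version:
  fixes f :: "real^'n \<Rightarrow> complex"
  assumes [measurable]: "f \<in> borel_measurable lebesgue"
  obtains g where "g \<in> borel_measurable borel" "AE x in lebesgue. f x = g x"
proof -
  have "(\<lambda>x. Re (f x)) \<in> borel_measurable lebesgue" "(\<lambda>x. Im (f x)) \<in> borel_measurable lebesgue"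
    by measurable
  from this[THEN completion_ex_borel_measurable_real]
  obtain u v where [measurable]: "u \<in> borel_measurable lborel" "v \<in> borel_measurable lborel"
    and uv: "AE x in lborel. Re (f x) = u x" "AE x in lborel. Im (f x) = v x"
    by blast
  from uv have "AE x in lborel. f x = Complex (u x) (v x)"
    by eventually_elim (simp add: complex_eq_iff)
  then have "AE x in lebesgue. f x = Complex (u x) (v x)" by (rule AE_completion)
  moreover have "(\<lambda>x. Complex (u x) (v x)) \<in> borel_measurable borel"
    by (simp add: borel_measurable_complex_iff)
  ultimately show ?thesis by (rule that[rotated])
qed

lemma measurable_riesz_integrand_lebesgue:
  fixes f :: "real^'n \<Rightarrow> complex"
  assumes [measurable]: "f \<in> borel_measurable lebesgue"
  shows "riesz_integrand \<gamma> f x \<in> borel_measurable lebesgue"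
proof -
  have [measurable]: "(\<lambda>z. norm (x - z) powr - (real CARD('n) - \<gamma>)) \<in> borel_measurable lebesgue"
    by (intro measurable_completion) measurable
  show ?thesis unfolding riesz_integrand_eq[abs_def] by measurable
qed

lemma AE_riesz_integrand_cong:
  "AE z in lebesgue. f z = g z \<Longrightarrow> AE z in lebesgue. riesz_integrand \<gamma> f x z = riesz_integrand \<gamma> g x z"
  by (erule eventually_mono) (simp add: riesz_integrand_def)

lemma frac_integral_cong_AE:
  fixes f g :: "real^'n \<Rightarrow> complex"
  assumes "f \<in> borel_measurable lebesgue" "g \<in> borel_measurable lebesgue" "AE x in lebesgue. f x = g x"
  shows "frac_integral \<gamma> f = frac_integral \<gamma> g"
  unfolding frac_integral_def using assms
  by (intro ext arg_cong[where f="\<lambda>z. _ *\<^sub>R z"] integral_cong_AE measurable_riesz_integrand_lebesgue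
      AE_riesz_integrand_cong)

lemma scaled_mass_cong_AE:
  "AE x in lebesgue. f x = g x \<Longrightarrow> scaled_mass a f y L = scaled_mass a g y L"
  unfolding scaled_mass_def by (intro arg_cong2[where f="(*)"] nn_integral_cong_AE refl)
      (auto elim!: eventually_mono)

lemma measurable_scaled_mass:
  fixes f :: "real^'n \<Rightarrow> complex"
  assumes [measurable]: "f \<in> borel_measurable borel"
  shows "(\<lambda>y. scaled_mass a f y L) \<in> borel_measurable lebesgue"
proof -
  have "(\<lambda>y. \<integral>\<^sup>+z\<in>cube y L. ennreal (norm (f z)) \<partial>lborel) \<in> borel_measurable borel"
    by (rule lborel.borel_measurable_nn_integral) (simp add: case_prod_beta)
  then have "(\<lambda>y. scaled_mass a f y L) \<in> borel_measurable lborel"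
    unfolding scaled_mass_lborel by measurable
  then show ?thesis by (rule measurable_completion)
qed

text \<open>Measurability in the centre matters for \<open>s = \<infinity>\<close>, where the essential supremum of a function
  that is not measurable is infinite.\<close>

lemma measurable_oscillation:
  fixes F :: "real^'n \<Rightarrow> complex"
  assumes [measurable]: "F \<in> borel_measurable borel" and l: "0 < l"
  shows "(\<lambda>y. cube_avg (\<lambda>x. ennreal (norm (F x - cube_mean F y l))) y l) \<in> borel_measurable lebesgue"
proof -
  have "(\<lambda>y. LINT x|lborel. indicator (cube y l) x *\<^sub>R F x) \<in> borel_measurable borel"
    by (rule lborel.borel_measurable_lebesgue_integral) (simp add: case_prod_beta)
  then have [measurable]: "(\<lambda>y. cube_mean F y l) \<in> borel_measurable borel"
    using l by (simp add: cube_mean_lborel set_lebesgue_integral_def)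
  have "(\<lambda>y. \<integral>\<^sup>+x\<in>cube y l. ennreal (norm (F x - cube_mean F y l)) \<partial>lborel) \<in> borel_measurable borel"
    by (rule lborel.borel_measurable_nn_integral) (simp add: case_prod_beta)
  then have "(\<lambda>y. cube_avg (\<lambda>x. ennreal (norm (F x - cube_mean F y l))) y l) \<in> borel_measurable lborel"
    unfolding cube_avg_lborel[OF l] by measurable
  then show ?thesis by (rule measurable_completion)
qed

lemma locally_integrable_frac_integral:
  fixes f :: "real^'n \<Rightarrow> complex"
  assumes f: "f \<in> borel_measurable lebesgue" and \<gamma>: "0 < \<gamma>" "\<gamma> < real CARD('n)"
  shows "locally_integrable (frac_integral \<gamma> f)"
proof -
  obtain g where g: "g \<in> borel_measurable borel" "AE x in lebesgue. f x = g x"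
    using ex_borel_version[OF f] .
  have "g \<in> borel_measurable lebesgue" using g by (simp add: measurable_completion)
  then show ?thesis
    using frac_integral_cong_AE[OF f _ g(2)] locally_integrable_frac_integral_borel[OF g(1) \<gamma>] by simp
qed

lemma suminf_third_powers: "(\<Sum>i. ennreal ((1 / 3) ^ Suc i)) \<le> 1"
proof -
  have "(\<lambda>i. (1 / 3) ^ Suc i) sums (1 / 3 * (1 / (1 - 1 / 3)) :: real)"
    unfolding power_Suc by (intro sums_mult geometric_sums) simp
  then have "(\<Sum>i. ennreal ((1 / 3) ^ Suc i)) = ennreal (1 / 3 * (1 / (1 - 1 / 3)))"
    by (intro suminf_ennreal_eq) auto
  also have "\<dots> \<le> ennreal 1" by (intro ennreal_leI) simp
  finally show ?thesis by simp
qed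

text \<open>The relation between the exponents turns \<open>1 / \<alpha> - 1 / p - 1 / s\<close> into \<open>- (1 / q)\<close>.\<close>

lemma amalgam_norm_eq:
  assumes "1 / s = ereal (1/\<alpha> - (1/p - 1/q))" and "0 < p" "0 < \<alpha>"
  shows "amalgam_norm (ereal p) s (ereal \<alpha>) \<nu> w \<mu> f =
    (SUP l\<in>{0<..}. Lnorm s \<mu> (\<lambda>y. epowr (weight_of w (cube y l)) (- (1 / q))
        * Lnorm (ereal p) \<nu> (\<lambda>x. ennreal (norm (f x)) * indicator (cube y l) x)))"
proof -
  have "real_of_ereal (1 / ereal \<alpha>) - real_of_ereal (1 / ereal p) - real_of_ereal (1 / s) = - (1 / q)"
    using assms by (simp add: one_ereal_def)
  then show ?thesis unfolding amalgam_norm_def by simp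
qed

lemma bmo_norm_frac_integral_le:
  fixes w \<nu> \<mu> :: "real^'n \<Rightarrow> real"
  assumes \<gamma>: "0 < \<gamma>" "\<gamma> < real CARD('n)" and p: "1 < p" "p < q" and r: "1 < r"
    and w: "weight w" and \<nu>: "weight \<nu>" and \<mu>: "weight \<mu>" and bump: "two_weight_bump \<gamma> p q r w \<nu>"
    and \<alpha>: "p \<le> \<alpha>" "ereal \<alpha> < s" "1 / s = ereal (1/\<alpha> - (1/p - 1/q))"
  obtains C :: real where "\<And>f. f \<in> borel_measurable lebesgue \<Longrightarrow>
    bmo_norm s \<mu> (frac_integral \<gamma> f) \<le> ennreal C * amalgam_norm (ereal p) s (ereal \<alpha>) \<nu> w \<mu> f"
proof -
  define a where "a = real CARD('n) - \<gamma>"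
  obtain K where K: "0 \<le> K" "\<And>(f :: real^'n \<Rightarrow> complex) y l. f \<in> borel_measurable borel \<Longrightarrow> 0 < l \<Longrightarrow>
    cube_avg (\<lambda>x. ennreal (norm (frac_integral \<gamma> f x - cube_mean (frac_integral \<gamma> f) y l))) y l
      \<le> ennreal K * (\<Sum>i. ennreal ((1 / 3) ^ Suc i) * scaled_mass a f y (3 ^ Suc i * l))"
    unfolding a_def using oscillation_frac_integral_borel[OF \<gamma>] by blast
  obtain C where C: "0 < C" "\<And>(f :: real^'n \<Rightarrow> complex) y l. f \<in> borel_measurable lebesgue \<Longrightarrow> 0 < l \<Longrightarrow>
    scaled_mass a f y l \<le> ennreal C *
      (epowr (weight_of w (cube y l)) (- (1 / q)) * Lnorm (ereal p) \<nu> (\<lambda>x. ennreal (norm (f x))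
          * indicator (cube y l) x))"
    unfolding a_def using scaled_mass_le_amalgam_integrand[OF \<gamma> p r w \<nu> bump] by blast
  have s: "1 < s" using p \<alpha> by (cases s) auto
  have "bmo_norm s \<mu> (frac_integral \<gamma> f) \<le> ennreal ((K + 1) * C) * amalgam_norm (ereal p) s (ereal \<alpha>) \<nu> w \<mu> f"
    (is "_ \<le> _ * ?N")
    if f: "f \<in> borel_measurable lebesgue" for f
    unfolding bmo_norm_def
  proof (rule SUP_least)
    fix l :: real assume "l \<in> {0<..}"
    then have l: "0 < l" by simp
    obtain g where g: "g \<in> borel_measurable borel" "AE x in lebesgue. f x = g x"
      using ex_borel_version[OF f] .
    have g': "g \<in> borel_measurable lebesgue" using g by (simp add: measurable_completion)
    have eq: "frac_integral \<gamma> f = frac_integral \<gamma> g" by (rule frac_integral_cong_AE[OF f g' g(2)])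
    let ?G = "\<lambda>l y. epowr (weight_of w (cube y l)) (- (1 / q))
        * Lnorm (ereal p) \<nu> (\<lambda>x. ennreal (norm (f x)) * indicator (cube y l) x)"
    show "Lnorm s \<mu> (\<lambda>y. cube_avg (\<lambda>x. ennreal (norm (frac_integral \<gamma> f x - cube_mean (frac_integral
        \<gamma> f) y l))) y l)
        \<le> ennreal ((K + 1) * C) * ?N"
      unfolding eq
    proof (rule Lnorm_suminf_le[OF suminf_third_powers _ _ \<mu> s])
      show "(\<lambda>y. cube_avg (\<lambda>x. ennreal (norm (frac_integral \<gamma> g x - cube_mean (frac_integral \<gamma> g) y
          l))) y l) \<in> borel_measurable lebesgue"
        using g l by (intro measurable_oscillation measurable_frac_integral) auto
      show "(\<lambda>y. scaled_mass a g y (3 ^ Suc i * l)) \<in> borel_measurable lebesgue" for i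
        using g by (intro measurable_scaled_mass) auto
      show "cube_avg (\<lambda>x. ennreal (norm (frac_integral \<gamma> g x - cube_mean (frac_integral \<gamma> g) y l))) y l
          \<le> ennreal (K + 1) * (\<Sum>i. ennreal ((1 / 3) ^ Suc i) * scaled_mass a g y (3 ^ Suc i * l))" for y
        by (rule order_trans[OF K(2)[OF g(1) l]]) (intro mult_right_mono ennreal_leI, auto)
      show "scaled_mass a g y (3 ^ Suc i * l) \<le> ennreal C * ?G (3 ^ Suc i * l) y" for i y
        using C(2)[OF f, of "3 ^ Suc i * l" y] l scaled_mass_cong_AE[OF g(2)] by simp
      show "Lnorm s \<mu> (?G (3 ^ Suc i * l)) \<le> ?N" for i
      proof -
        have N_eq: "?N = (SUP l\<in>{0<..}. Lnorm s \<mu> (?G l))"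
          using p \<alpha> by (intro amalgam_norm_eq) auto
        show ?thesis unfolding N_eq using l by (intro SUP_upper) auto
      qed
    qed (use K C in auto)
  qed
  then show ?thesis using that by blast
qed

section \<open>Reverse doubling and convergence\<close>

lemma weight_of_mono: "A \<subseteq> B \<Longrightarrow> weight_of w A \<le> weight_of w B"
  unfolding weight_of_def by (intro nn_integral_mono mult_left_mono) (auto simp: indicator_def)

lemma Delta2_doubling:
  fixes \<mu> :: "real^'n \<Rightarrow> real"
  assumes "\<mu> \<in> Delta2"
  obtains D where "0 < D" and "\<And>y l. 0 < l \<Longrightarrow> weight_of \<mu> (cube y (2 * l)) \<le> ennreal D * weight_of \<mu> (cube y l)"
proof -
  obtain D where D: "0 < D" "\<And>y l. 0 < l \<Longrightarrow> weight_of \<mu> (dilated_cube 2 y l) \<le> ennreal D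
      * weight_of \<mu> (cube y l)"
    using assms by (auto simp: Delta2_def)
  have "weight_of \<mu> (cube y (2 * l)) \<le> weight_of \<mu> (dilated_cube 2 y l)" if "0 < l" for y :: "real^'n" and l
  proof (intro weight_of_mono)
    have "1 \<le> sqrt (real CARD('n))" by (simp add: Suc_leI)
    then show "cube y (2 * l) \<subseteq> dilated_cube 2 y l"
      unfolding dilated_cube_def using that by (intro cube_mono) simp
  qed
  with D show ?thesis using that by (meson order_trans)
qed

lemma weight_of_cube_pos:
  fixes \<mu> :: "real^'n \<Rightarrow> real"
  assumes \<mu>: "\<mu> \<in> Delta2" and nz: "\<not> (AE y in lebesgue. \<mu> y = 0)" and l: "0 < l"
  shows "weight_of \<mu> (cube 0 l) \<noteq> 0"
proof
  assume zero: "weight_of \<mu> (cube 0 l) = 0"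
  have wt: "weight \<mu>" using \<mu> by (simp add: Delta2_def)
  then have [measurable]: "\<mu> \<in> borel_measurable lebesgue" by (simp add: weight_def
      locally_integrable_measurable)
  obtain D where D: "0 < D" "\<And>y l. 0 < l \<Longrightarrow> weight_of \<mu> (cube y (2 * l)) \<le> ennreal D * weight_of \<mu> (cube y l)"
    using Delta2_doubling[OF \<mu>] by blast
  have zk: "weight_of \<mu> (cube 0 (2 ^ k * l)) = 0" for k
  proof (induction k)
    case (Suc k)
    then show ?case using D(2)[of "2 ^ k * l" 0] l by (simp add: mult.assoc)
  qed (simp add: zero)
  have "AE x in lebesgue. x \<in> cube 0 (2 ^ k * l) \<longrightarrow> \<mu> x = 0" for k
  proof -
    have "AE x in lebesgue. ennreal (\<mu> x) * indicator (cube 0 (2 ^ k * l)) x = 0"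
      using zk[of k] unfolding weight_of_def by (subst (asm) nn_integral_0_iff_AE) auto
    then show ?thesis
      by eventually_elim (use wt in \<open>auto simp: weight_def indicator_def ennreal_eq_0_iff intro: antisym\<close>)
  qed
  then have "AE x in lebesgue. \<forall>k. x \<in> cube 0 (2 ^ k * l) \<longrightarrow> \<mu> x = 0"
    by (simp only: AE_all_countable) blast
  moreover have "\<exists>k. x \<in> cube 0 (2 ^ k * l)" for x :: "real^'n"
  proof -
    obtain m where m: "0 < m" "x \<in> cube 0 m" using compact_subset_cube[of "{x}"] by auto
    obtain k where "m / l < 2 ^ k" using real_arch_pow[of 2 "m / l"] by auto
    then have "m \<le> 2 ^ k * l" using l by (simp add: field_simps)
    then show ?thesis using m cube_mono by blast
  qed
  ultimately have "AE x in lebesgue. \<mu> x = 0" by (auto elim!: eventually_mono)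
  with nz show False by simp
qed

text \<open>The cube of side \<open>l / 2\<close> around \<open>(l, \<dots>, l)\<close> is disjoint from \<open>cube 0 l\<close>, is contained in
  \<open>cube 0 (3 * l)\<close>, and by doubling carries a fixed fraction of the weight of \<open>cube 0 l\<close>.\<close>

lemma reverse_doubling:
  fixes \<mu> :: "real^'n \<Rightarrow> real"
  assumes \<mu>: "\<mu> \<in> Delta2"
  obtains \<rho> where "1 < \<rho>"
    and "\<And>l. 0 < l \<Longrightarrow> ennreal \<rho> * weight_of \<mu> (cube 0 l) \<le> weight_of \<mu> (cube 0 (3 * l))"
proof -
  have wt: "weight \<mu>" using \<mu> by (simp add: Delta2_def)
  then have [measurable]: "\<mu> \<in> borel_measurable lebesgue" by (simp add: weight_def
      locally_integrable_measurable)
  obtain D where D: "0 < D" "\<And>y l. 0 < l \<Longrightarrow> weight_of \<mu> (cube y (2 * l)) \<le> ennreal D * weight_of \<mu> (cube y l)"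
    using Delta2_doubling[OF \<mu>] by blast
  have "ennreal (1 + 1 / D ^ 3) * weight_of \<mu> (cube 0 l) \<le> weight_of \<mu> (cube 0 (3 * l))" if l: "0 < l" for l
  proof -
    define z :: "real^'n" where "z = (\<chi> i. l)"
    let ?E = "cube z (l / 2)"
    have "cube 0 l \<subseteq> cube z (2 * (2 * (2 * (l / 2))))"
    proof
      fix x :: "real^'n" assume x: "x \<in> cube 0 l"
      have "\<bar>x $ i - l\<bar> \<le> 2 * l" for i
      proof -
        have "\<bar>x $ i\<bar> \<le> l / 2" using x by (simp add: mem_cube)
        then show ?thesis using l by linarith
      qed
      then show "x \<in> cube z (2 * (2 * (2 * (l / 2))))" by (simp add: mem_cube z_def)
    qed
    then have "weight_of \<mu> (cube 0 l) \<le> weight_of \<mu> (cube z (2 * (2 * (2 * (l / 2)))))"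
      by (rule weight_of_mono)
    also have "\<dots> \<le> ennreal D * (ennreal D * (ennreal D * weight_of \<mu> ?E))"
      using l by (intro order_trans[OF D(2)] mult_left_mono order.refl) auto
    also have "\<dots> = ennreal (D ^ 3) * weight_of \<mu> ?E"
      using D by (simp add: ennreal_mult power3_eq_cube mult.assoc)
    finally have big: "weight_of \<mu> (cube 0 l) \<le> ennreal (D ^ 3) * weight_of \<mu> ?E" .
    have sub: "cube 0 l \<subseteq> cube 0 (3 * l)" using l by (intro cube_mono) simp
    have subE: "?E \<subseteq> cube 0 (3 * l)"
    proof
      fix x assume x: "x \<in> ?E"
      have "\<bar>x $ i\<bar> \<le> 3 * l / 2" for i
      proof -
        have "\<bar>x $ i - l\<bar> \<le> l / 4" using x by (simp add: mem_cube z_def)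
        then show ?thesis using l by linarith
      qed
      then show "x \<in> cube 0 (3 * l)" by (simp add: mem_cube)
    qed
    have disj: "x \<notin> cube 0 l" if "x \<in> ?E" for x
    proof
      fix i :: 'n
      assume "x \<in> cube 0 l"
      then have "\<bar>x $ i\<bar> \<le> l / 2" by (simp add: mem_cube)
      moreover have "\<bar>x $ i - l\<bar> \<le> l / 4" using that by (simp add: mem_cube z_def)
      ultimately show False using l by linarith
    qed
    have "weight_of \<mu> (cube 0 l) + weight_of \<mu> ?E =
        (\<integral>\<^sup>+x. ennreal (\<mu> x) * indicator (cube 0 l) x + ennreal (\<mu> x) * indicator ?E x \<partial>lebesgue)"
      unfolding weight_of_def by (subst nn_integral_add) auto
    also have "\<dots> \<le> weight_of \<mu> (cube 0 (3 * l))"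
      unfolding weight_of_def using disj sub subE
      by (intro nn_integral_mono) (auto simp: indicator_def)
    finally have add: "weight_of \<mu> (cube 0 l) + weight_of \<mu> ?E \<le> weight_of \<mu> (cube 0 (3 * l))" .
    have "ennreal (1 / D ^ 3) * weight_of \<mu> (cube 0 l) \<le> ennreal (1 / D ^ 3) * (ennreal (D ^ 3)
        * weight_of \<mu> ?E)"
      by (intro mult_left_mono big) auto
    also have "\<dots> = weight_of \<mu> ?E"
      using D by (simp add: mult.assoc[symmetric] ennreal_mult[symmetric])
    finally have "ennreal (1 / D ^ 3) * weight_of \<mu> (cube 0 l) \<le> weight_of \<mu> ?E" .
    then have "ennreal (1 + 1 / D ^ 3) * weight_of \<mu> (cube 0 l) \<le> weight_of \<mu> (cube 0 l) + weight_of \<mu> ?E"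
      using D by (simp add: distrib_right add_left_mono)
    with add show ?thesis by (rule order_trans[rotated])
  qed
  moreover have "1 < 1 + 1 / D ^ 3" using D by simp
  ultimately show ?thesis using that by blast
qed

text \<open>At infinity the kernel is dominated by a sum over the cubes of side \<open>3 ^ i\<close> around the
  origin, so convergence of the potential reduces to summability of the scaled masses of these
  cubes.\<close>

lemma kernel_le_cubes:
  assumes a: "0 < a"
  shows "ennreal ((1 + norm (z :: real^'n)) powr - a)
    \<le> (\<Sum>i. ennreal (6 powr a) * (ennreal ((3 ^ i) powr - a) * indicator (cube 0 (3 ^ i)) z))"
    (is "_ \<le> (\<Sum>i. ?t i)")
proof (cases "z \<in> cube 0 1")
  case True
  have "(1 + norm z) powr - a \<le> 1 powr - a" using a by (intro powr_neg_anti) auto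
  also have "\<dots> \<le> 6 powr a" using a by (simp add: ge_one_powr_ge_zero)
  finally have "ennreal ((1 + norm z) powr - a) \<le> ?t 0" using True by (simp add: ennreal_leI)
  also have "\<dots> \<le> (\<Sum>i. ?t i)" by (rule ennreal_suminf_term_le)
  finally show ?thesis .
next
  case False
  obtain j where j: "z \<in> cube 0 (3 ^ j)" using ex_cube_power[of 1 z 0] by auto
  obtain i where i: "z \<notin> cube 0 (3 ^ i)" "z \<in> cube 0 (3 ^ Suc i)"
  proof -
    have "z \<notin> cube 0 (3 ^ 0)" using False by simp
    then show thesis using j nat_induct[of "\<lambda>i. z \<notin> cube 0 (3 ^ i)" j] that by blast
  qed
  have "3 ^ Suc i / 6 \<le> 1 + norm z" using norm_ge_cube[OF i(1)] by simp
  then have "(1 + norm z) powr - a \<le> (3 ^ Suc i / 6) powr - a"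
    using a by (intro powr_neg_anti) auto
  also have "\<dots> = 6 powr a * (3 ^ Suc i) powr - a" 
    by (subst powr_divide) (simp_all add: powr_minus divide_inverse mult.commute del: power_Suc)
  finally have "ennreal ((1 + norm z) powr - a) \<le> ?t (Suc i)"
    using i by (simp add: ennreal_mult[symmetric] ennreal_leI)
  also have "\<dots> \<le> (\<Sum>i. ?t i)" by (rule ennreal_suminf_term_le)
  finally show ?thesis .
qed

lemma finite_tail_if_suminf:
  fixes f :: "real^'n \<Rightarrow> complex"
  assumes a: "0 < a" and [measurable]: "f \<in> borel_measurable borel"
    and fin: "(\<Sum>i. scaled_mass a f 0 (3 ^ i)) < \<infinity>"
  shows "finite_tail a f"
proof -
  have "(\<integral>\<^sup>+z. ennreal (norm (f z)) * ennreal ((1 + norm z) powr - a) \<partial>lborel)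
      \<le> (\<integral>\<^sup>+z. ennreal (norm (f z)) * (\<Sum>i. ennreal (6 powr a) * (ennreal ((3 ^ i) powr - a)
          * indicator (cube 0 (3 ^ i)) z)) \<partial>lborel)"
    by (intro nn_integral_mono mult_left_mono kernel_le_cubes a) auto
  also have "\<dots> = (\<integral>\<^sup>+z. (\<Sum>i. ennreal (6 powr a) * (ennreal ((3 ^ i) powr - a)
      * (ennreal (norm (f z)) * indicator (cube 0 (3 ^ i)) z))) \<partial>lborel)"
    by (intro nn_integral_cong, subst ennreal_suminf_cmult[symmetric]) (simp add: mult_ac)
  also have "\<dots> = (\<Sum>i. ennreal (6 powr a) * scaled_mass a f 0 (3 ^ i))"
    unfolding scaled_mass_lborel
    by (subst nn_integral_suminf, measurable, subst nn_integral_cmult, measurable, subst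
        nn_integral_cmult, measurable)
  also have "\<dots> = ennreal (6 powr a) * (\<Sum>i. scaled_mass a f 0 (3 ^ i))"
    by (rule ennreal_suminf_cmult)
  also have "\<dots> < \<infinity>" using fin by (simp add: ennreal_mult_less_top)
  finally show ?thesis by (simp add: finite_tail_def)
qed

lemma scaled_mass_shift:
  assumes l: "0 < l" and y: "y \<in> cube 0 l"
  shows "scaled_mass a f 0 l \<le> ennreal (3 powr a) * scaled_mass a f y (3 * l)"
proof -
  have "cube 0 l \<subseteq> cube y (l + l)"
    using y cube_trans[of 0 y l _ l] by (auto simp: cube_commute[of y 0])
  also have "\<dots> \<subseteq> cube y (3 * l)" using l by (intro cube_mono) simp
  finally have sub: "cube 0 l \<subseteq> cube y (3 * l)" .
  have eq: "l powr - a = 3 powr a * (3 * l) powr - a"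
    using l by (simp add: powr_mult powr_minus)
  have "scaled_mass a f 0 l \<le> ennreal (l powr - a) * (\<integral>\<^sup>+z\<in>cube y (3 * l). ennreal (norm (f z)) \<partial>lebesgue)"
    unfolding scaled_mass_def using sub
    by (intro mult_left_mono nn_integral_mono) (auto simp: indicator_def)
  also have "\<dots> = ennreal (3 powr a) * scaled_mass a f y (3 * l)"
    unfolding scaled_mass_def eq by (simp add: ennreal_mult mult.assoc)
  finally show ?thesis .
qed

text \<open>Around every point of \<open>cube 0 (3 ^ i)\<close> there is a cube of side \<open>3 * 3 ^ i\<close> whose scaled mass
  is at least comparable. A uniform bound for the norms thus bounds the scaled mass of
  \<open>cube 0 (3 ^ i)\<close> by a multiple of its weight to the power \<open>- (1 / \<sigma>)\<close>, which decays
  geometrically by reverse doubling.\<close>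

lemma suminf_scaled_mass_finite:
  fixes f :: "real^'n \<Rightarrow> complex"
  assumes [measurable]: "f \<in> borel_measurable borel"
    and \<mu>: "\<mu> \<in> Delta2" and nz: "\<not> (AE y in lebesgue. \<mu> y = 0)" and \<sigma>: "1 < \<sigma>" and R: "R < \<infinity>"
    and bound: "\<And>l. 0 < l \<Longrightarrow> Lnorm (ereal \<sigma>) \<mu> (\<lambda>y. scaled_mass a f y l) \<le> R"
  shows "(\<Sum>i. scaled_mass a f 0 (3 ^ i)) < \<infinity>"
proof -
  have wt: "weight \<mu>" using \<mu> by (simp add: Delta2_def)
  then have [measurable]: "\<mu> \<in> borel_measurable lebesgue" by (simp add: weight_def
      locally_integrable_measurable)
  have [measurable]: "(\<lambda>y. scaled_mass a f y l) \<in> borel_measurable lebesgue" for l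
    by (rule measurable_scaled_mass) measurable
  obtain \<rho> where \<rho>: "1 < \<rho>"
    "\<And>l. 0 < l \<Longrightarrow> ennreal \<rho> * weight_of \<mu> (cube 0 l) \<le> weight_of \<mu> (cube 0 (3 * l))"
    using reverse_doubling[OF \<mu>] by blast
  obtain m where m: "weight_of \<mu> (cube 0 1) = ennreal m" "0 < m"
    using weight_of_cube_pos[OF \<mu> nz, of 1] weight_of_cube_finite[OF wt, of 0 1]
    by (cases "weight_of \<mu> (cube 0 1)" rule: ennreal_cases) (auto simp: less_le)
  have growth: "ennreal (m * \<rho> ^ i) \<le> weight_of \<mu> (cube 0 (3 ^ i))" for i
  proof (induction i)
    case (Suc i)
    have "ennreal (m * \<rho> ^ Suc i) = ennreal \<rho> * ennreal (m * \<rho> ^ i)"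
      using \<rho> m by (simp add: ennreal_mult[symmetric] mult_ac)
    also have "\<dots> \<le> ennreal \<rho> * weight_of \<mu> (cube 0 (3 ^ i))"
      by (intro mult_left_mono Suc.IH) auto
    also have "\<dots> \<le> weight_of \<mu> (cube 0 (3 ^ Suc i))" using \<rho>(2)[of "3 ^ i"] by simp
    finally show ?case .
  qed (simp add: m)
  obtain R' where R': "ennreal (3 powr a) * R = ennreal R'" "0 \<le> R'"
    using R by (cases "ennreal (3 powr a) * R" rule: ennreal_cases) (auto simp: ennreal_mult_eq_top_iff)
  define c where "c = R' * m powr - (1 / \<sigma>)"
  have step: "scaled_mass a f 0 (3 ^ i) \<le> ennreal (c * (\<rho> powr - (1 / \<sigma>)) ^ i)" for i
  proof -
    let ?S = "scaled_mass a f 0 (3 ^ i)"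
    have "epowr ?S \<sigma> * weight_of \<mu> (cube 0 (3 ^ i)) = (\<integral>\<^sup>+y. epowr ?S \<sigma> * (ennreal (\<mu> y)
        * indicator (cube 0 (3 ^ i)) y) \<partial>lebesgue)"
      unfolding weight_of_def by (intro nn_integral_cmult[symmetric]) measurable
    also have "\<dots> \<le> (\<integral>\<^sup>+y. epowr (ennreal (3 powr a)) \<sigma> * (epowr (scaled_mass a f y (3 * 3 ^ i)) \<sigma>
        * ennreal (\<mu> y)) \<partial>lebesgue)"
    proof (rule nn_integral_mono)
      fix y
      show "epowr ?S \<sigma> * (ennreal (\<mu> y) * indicator (cube 0 (3 ^ i)) y)
          \<le> epowr (ennreal (3 powr a)) \<sigma> * (epowr (scaled_mass a f y (3 * 3 ^ i)) \<sigma> * ennreal (\<mu> y))"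
      proof (cases "y \<in> cube 0 (3 ^ i)")
        case True
        then have "epowr ?S \<sigma> \<le> epowr (ennreal (3 powr a)) \<sigma> * epowr (scaled_mass a f y (3 * 3 ^ i)) \<sigma>"
          using \<sigma> by (subst epowr_mult[symmetric]) (auto intro!: epowr_mono scaled_mass_shift)
        then show ?thesis using True by (simp add: mult.assoc[symmetric] mult_right_mono)
      qed simp
    qed
    also have "\<dots> = epowr (ennreal (3 powr a)) \<sigma> * (\<integral>\<^sup>+y. epowr (scaled_mass a f y (3 * 3 ^ i)) \<sigma>
        * ennreal (\<mu> y) \<partial>lebesgue)"
      by (intro nn_integral_cmult) measurable
    also have "\<dots> \<le> epowr (ennreal (3 powr a)) \<sigma> * epowr R \<sigma>"
    proof (intro mult_left_mono)
      have "epowr (Lnorm (ereal \<sigma>) \<mu> (\<lambda>y. scaled_mass a f y (3 * 3 ^ i))) \<sigma> \<le> epowr R \<sigma>"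
        using \<sigma> by (intro epowr_mono bound) auto
      then show "(\<integral>\<^sup>+y. epowr (scaled_mass a f y (3 * 3 ^ i)) \<sigma> * ennreal (\<mu> y) \<partial>lebesgue) \<le> epowr R \<sigma>"
        using \<sigma> by (simp add: Lnorm_def epowr_cancel')
    qed simp
    also have "\<dots> = epowr (ennreal R') \<sigma>" using \<sigma> by (simp add: epowr_mult[symmetric] R')
    finally have "epowr ?S \<sigma> * ennreal (m * \<rho> ^ i) \<le> epowr (ennreal R') \<sigma>"
      using growth[of i] by (meson mult_left_mono order_trans zero_le)
    then have "epowr (epowr ?S \<sigma> * ennreal (m * \<rho> ^ i)) (1 / \<sigma>) \<le> epowr (epowr (ennreal R') \<sigma>) (1 / \<sigma>)"
      using \<sigma> by (intro epowr_mono) auto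
    then have "?S * ennreal ((m * \<rho> ^ i) powr (1 / \<sigma>)) \<le> ennreal R'"
      using \<sigma> m \<rho> by (simp add: epowr_mult epowr_cancel epowr_ennreal)
    then have "?S * ennreal ((m * \<rho> ^ i) powr (1 / \<sigma>)) * ennreal ((m * \<rho> ^ i) powr - (1 / \<sigma>))
        \<le> ennreal R' * ennreal ((m * \<rho> ^ i) powr - (1 / \<sigma>))"
      by (rule mult_right_mono) simp
    moreover have "ennreal ((m * \<rho> ^ i) powr (1 / \<sigma>)) * ennreal ((m * \<rho> ^ i) powr - (1 / \<sigma>)) = 1"
      using m \<rho> by (simp add: ennreal_mult[symmetric] powr_minus)
    moreover have "(m * \<rho> ^ i) powr - (1 / \<sigma>) = m powr - (1 / \<sigma>) * (\<rho> powr - (1 / \<sigma>)) ^ i"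
    proof -
      have "(\<rho> ^ i) powr - (1 / \<sigma>) = (\<rho> powr real i) powr - (1 / \<sigma>)" using \<rho> by (simp add: powr_realpow)
      also have "\<dots> = \<rho> powr (- (1 / \<sigma>) * real i)" by (simp only: powr_powr mult.commute)
      also have "\<dots> = (\<rho> powr - (1 / \<sigma>)) ^ i" using \<rho> by (simp add: powr_power mult.commute)
      finally show ?thesis using m \<rho> by (simp add: powr_mult)
    qed
    ultimately show ?thesis using R' by (simp add: mult.assoc c_def ennreal_mult[symmetric])
  qed
  have "(\<Sum>i. scaled_mass a f 0 (3 ^ i)) \<le> (\<Sum>i. ennreal (c * (\<rho> powr - (1 / \<sigma>)) ^ i))"
    by (intro suminf_le step) auto
  also have "\<dots> = ennreal (c * (1 / (1 - \<rho> powr - (1 / \<sigma>))))"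
  proof (intro suminf_ennreal_eq sums_mult geometric_sums)
    show "norm (\<rho> powr - (1 / \<sigma>)) < 1" using \<rho> \<sigma> by (simp add: powr_less_one)
  qed (use R' in \<open>simp add: c_def\<close>)
  also have "\<dots> < \<infinity>" by simp
  finally show ?thesis .
qed

lemma frac_integral_converges_amalgam:
  fixes w \<nu> \<mu> :: "real^'n \<Rightarrow> real"
  assumes \<gamma>: "0 < \<gamma>" "\<gamma> < real CARD('n)" and p: "1 < p" "p < q" and r: "1 < r"
    and w: "weight w" and \<nu>: "weight \<nu>" and \<mu>: "\<mu> \<in> Delta2" and bump: "two_weight_bump \<gamma> p q r w \<nu>"
    and \<alpha>: "p \<le> \<alpha>" "ereal \<alpha> < s" "1 / s = ereal (1/\<alpha> - (1/p - 1/q))"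
    and s: "s < \<infinity>" and nz: "\<not> (AE y in lebesgue. \<mu> y = 0)"
    and f: "f \<in> amalgam (ereal p) s (ereal \<alpha>) \<nu> w \<mu>"
  shows "frac_integral_converges \<gamma> f"
proof -
  define a where "a = real CARD('n) - \<gamma>"
  have a: "0 < a" using \<gamma> by (simp add: a_def)
  obtain \<sigma> where \<sigma>: "s = ereal \<sigma>" "1 < \<sigma>" using s p \<alpha> by (cases s) auto
  have wt: "weight \<mu>" using \<mu> by (simp add: Delta2_def)
  define N where "N = amalgam_norm (ereal p) s (ereal \<alpha>) \<nu> w \<mu> f"
  have N_eq: "N = (SUP l\<in>{0<..}. Lnorm s \<mu> (\<lambda>y. epowr (weight_of w (cube y l)) (- (1 / q))
        * Lnorm (ereal p) \<nu> (\<lambda>x. ennreal (norm (f x)) * indicator (cube y l) x)))"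
    unfolding N_def using p \<alpha> by (intro amalgam_norm_eq) auto
  have N: "N < \<infinity>" and f: "f \<in> borel_measurable lebesgue"
    using f by (auto simp: amalgam_def N_def locally_integrable_measurable)
  obtain C where C: "0 < C" "\<And>(f :: real^'n \<Rightarrow> complex) y l. f \<in> borel_measurable lebesgue \<Longrightarrow> 0 < l \<Longrightarrow>
    scaled_mass a f y l \<le> ennreal C *
      (epowr (weight_of w (cube y l)) (- (1 / q)) * Lnorm (ereal p) \<nu> (\<lambda>x. ennreal (norm (f x))
          * indicator (cube y l) x))"
    unfolding a_def using scaled_mass_le_amalgam_integrand[OF \<gamma> p r w \<nu> bump] by blast
  obtain g where g: "g \<in> borel_measurable borel" "AE x in lebesgue. f x = g x"
    using ex_borel_version[OF f] .
  have g': "g \<in> borel_measurable lebesgue" using g by (simp add: measurable_completion)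
  \<comment> \<open>The lemma on series is applied to a series of equal terms; the constant 3 is the inverse of the
    first coefficient.\<close>
  have "Lnorm (ereal \<sigma>) \<mu> (\<lambda>y. scaled_mass a g y l) \<le> ennreal (3 * C) * N" if l: "0 < l" for l
  proof (rule Lnorm_suminf_le[OF suminf_third_powers _ _ wt])
    show "scaled_mass a g y l \<le> ennreal 3 * (\<Sum>i. ennreal ((1 / 3) ^ Suc i) * scaled_mass a g y l)" for y
    proof -
      have "ennreal 3 * ennreal ((1 / 3) ^ Suc 0) = 1"
        by (subst ennreal_mult[symmetric]) auto
      then have "scaled_mass a g y l = ennreal 3 * (ennreal ((1 / 3) ^ Suc 0) * scaled_mass a g y l)"
        by (simp only: mult.assoc[symmetric] mult_1_left)
      also have "\<dots> \<le> ennreal 3 * (\<Sum>i. ennreal ((1 / 3) ^ Suc i) * scaled_mass a g y l)"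
        by (intro mult_left_mono ennreal_suminf_term_le) auto
      finally show ?thesis .
    qed
    show "(\<lambda>y. scaled_mass a g y l) \<in> borel_measurable lebesgue"
      "(\<lambda>y. scaled_mass a g y l) \<in> borel_measurable lebesgue"
      using g by (auto intro: measurable_scaled_mass)
    show "scaled_mass a g y l \<le> ennreal C * (epowr (weight_of w (cube y l)) (- (1 / q)) *
        Lnorm (ereal p) \<nu> (\<lambda>x. ennreal (norm (f x)) * indicator (cube y l) x))" for y
      using C(2)[OF f l] scaled_mass_cong_AE[OF g(2)] by simp
    show "Lnorm (ereal \<sigma>) \<mu> (\<lambda>y. epowr (weight_of w (cube y l)) (- (1 / q)) *
        Lnorm (ereal p) \<nu> (\<lambda>x. ennreal (norm (f x)) * indicator (cube y l) x)) \<le> N"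
      unfolding N_eq \<sigma>(1)[symmetric]
      using l by (intro SUP_upper2[of l]) auto
  qed (use \<sigma> C in auto)
  moreover have "ennreal (3 * C) * N < \<infinity>" using N by (simp add: ennreal_mult_less_top)
  ultimately have "(\<Sum>i. scaled_mass a g 0 (3 ^ i)) < \<infinity>"
    using suminf_scaled_mass_finite[OF g(1) \<mu> nz \<sigma>(2)] by blast
  then have "finite_tail a g" using finite_tail_if_suminf[OF a g(1)] by blast
  then have "AE x in lborel. integrable lborel (riesz_integrand \<gamma> g x)"
    using AE_integrable_riesz_integrand[OF g(1) \<gamma>] by (simp add: a_def)
  then have "AE x in lebesgue. integrable lborel (riesz_integrand \<gamma> g x)" by (rule AE_completion)
  moreover have "integrable lebesgue (riesz_integrand \<gamma> f x) \<longleftrightarrow> integrable lborel (riesz_integrand \<gamma> g x)" for x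
    unfolding integrable_riesz_integrand_lborel[OF g(1), symmetric]
    by (intro integrable_cong_AE measurable_riesz_integrand_lebesgue AE_riesz_integrand_cong f g g')
  ultimately show ?thesis by (simp add: frac_integral_converges_def)
qed

section \<open>Boundedness from the amalgam space into the BMO-type space\<close>

theorem theorem2p6:
  fixes \<gamma> p q r \<alpha> :: real and s :: ereal
    and w \<nu> \<mu> :: "real^'n \<Rightarrow> real"
  assumes "0 < \<gamma>" and "\<gamma> < real CARD('n)"
    and "1 < p" and "p < q"
    and "\<mu> \<in> Delta2"
    and "weight w" and "weight \<nu>"
    and "1 < r" and "two_weight_bump \<gamma> p q r w \<nu>"
    and "p \<le> \<alpha>" and "ereal \<alpha> < s"
    and "1 / s = ereal (1/\<alpha> - (1/p - 1/q))"
    and "w \<in> Delta2"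
  shows "bounded_operator (frac_integral \<gamma>)
           (amalgam (ereal p) s (ereal \<alpha>) \<nu> w \<mu>) (amalgam_norm (ereal p) s (ereal \<alpha>) \<nu> w \<mu>)
           (bmo_space s \<mu>) (bmo_norm s \<mu>)
         \<and> (s < \<infinity> \<longrightarrow> \<not> (AE y in lebesgue. \<mu> y = 0) \<longrightarrow>
              (\<forall>f \<in> amalgam (ereal p) s (ereal \<alpha>) \<nu> w \<mu>. frac_integral_converges \<gamma> f))"
proof
  let ?N = "amalgam_norm (ereal p) s (ereal \<alpha>) \<nu> w \<mu>"
  have "weight \<mu>" using assms by (simp add: Delta2_def)
  then obtain C :: real where C: "\<And>f. f \<in> borel_measurable lebesgue \<Longrightarrow>
      bmo_norm s \<mu> (frac_integral \<gamma> f) \<le> ennreal C * ?N f"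
    using bmo_norm_frac_integral_le[of \<gamma> p q r w \<nu> \<mu> \<alpha> s] assms by blast
  show "bounded_operator (frac_integral \<gamma>) (amalgam (ereal p) s (ereal \<alpha>) \<nu> w \<mu>) ?N (bmo_space s \<mu>)
      (bmo_norm s \<mu>)"
    unfolding bounded_operator_def
  proof (intro exI[of _ C] ballI conjI)
    fix f assume "f \<in> amalgam (ereal p) s (ereal \<alpha>) \<nu> w \<mu>"
    then have f: "f \<in> borel_measurable lebesgue" and N: "?N f < \<infinity>"
      by (auto simp: amalgam_def locally_integrable_measurable)
    show "bmo_norm s \<mu> (frac_integral \<gamma> f) \<le> ennreal C * ?N f" by (rule C[OF f])
    also have "\<dots> < \<infinity>" using N by (simp add: ennreal_mult_less_top)
    finally show "frac_integral \<gamma> f \<in> bmo_space s \<mu>"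
      using locally_integrable_frac_integral[OF f assms(1,2)] by (simp add: bmo_space_def)
  qed
  show "s < \<infinity> \<longrightarrow> \<not> (AE y in lebesgue. \<mu> y = 0) \<longrightarrow>
      (\<forall>f \<in> amalgam (ereal p) s (ereal \<alpha>) \<nu> w \<mu>. frac_integral_converges \<gamma> f)"
    using frac_integral_converges_amalgam[of \<gamma> p q r w \<nu> \<mu> \<alpha> s] assms by blast
qed

end
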